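(* $$\limsup_{n\to\infty}\ \frac{\Phi_1(n)}{(\log\log n)^2(\log\log\log n)}\,=\,e^{\gamma}.$$
   Context: For a positive integer $n$ with prime factorization $n=p_1^{\alpha_1}\cdots p_r^{\alpha_r}$, $$\Phi_1(n)=\sum_{\mu_1=0}^{\alpha_1}\cdots\sum_{\mu_r=0}^{\alpha_r}\frac{\sum_{i=1}^{r}\mu_i(\log p_i)(\log\log p_i)}{p_1^{\mu_1}\cdots p_r^{\mu_r}},$$ i.e. the sum is over all divisors $p_1^{\mu_1}\cdots p_r^{\mu_r}$ of $n$. Here $\gamma$ is Euler's constant. Convention: $\log\log x$ equals $1$ if $0\le x\le e^{e}$, and equals $\log\log x$ in the usual sense if $x>e^{e}$; $\log\log\log x$ equals $1$ if $0\le x\le e^{e^{e}}$, and equals $\log\log\log x$ in the usual sense if $x>e^{e^{e}}$. *)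

theory Defs
  imports "HOL-Analysis.Analysis" "HOL-Computational_Algebra.Primes"
begin

text \<open>Iterated logarithms with the convention that small arguments are sent to 1; since
  \<open>ln (ln (exp (exp 1))) = 1\<close> and likewise for the triple iterate, both are continuous. In
  particular \<^term>\<open>loglog p = 1\<close> for the primes up to 13.\<close>

definition loglog :: "real \<Rightarrow> real" where
  "loglog x = (if x \<le> exp (exp 1) then 1 else ln (ln x))"

definition logloglog :: "real \<Rightarrow> real" where
  "logloglog x = (if x \<le> exp (exp (exp 1)) then 1 else ln (ln (ln x)))"

text \<open>The index \<open>\<mu>\<close> ranges over the exponent vectors \<open>(\<mu> p)\<close>, \<open>p\<close> a prime factor of \<open>n\<close>,
  with \<open>0 \<le> \<mu> p \<le> multiplicity p n\<close>; these correspond to the divisors of \<open>n > 0\<close>.\<close>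

definition Phi1 :: "nat \<Rightarrow> real" where
  "Phi1 n = (\<Sum>\<mu>\<in>(\<Pi>\<^sub>E p\<in>prime_factors n. {0..multiplicity p n}).
      (\<Sum>p\<in>prime_factors n. real (\<mu> p) * ln (real p) * loglog (real p)) /
      (\<Prod>p\<in>prime_factors n. real p ^ \<mu> p))"

end

theory Submission
  imports Defs "HOL-Real_Asymp.Real_Asymp"
begin

text \<open>
  Reading the sum over exponent vectors as a product over primes (\<open>Phi1_eq\<close>) shows that
  \<^term>\<open>Phi1 n\<close> equals \<open>\<sigma>(n) / n\<close> times a sum over the primes \<open>p\<close> dividing \<open>n\<close> of \<open>ln p * loglog p\<close> times
  the mean exponent of \<open>p\<close> in a divisor \<open>d\<close> of \<open>n\<close> chosen with probability proportional to \<open>1 / d\<close>. That mean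
  lies between \<open>1 / (p + 1)\<close> and \<open>1 / (p - 1)\<close> (\<open>Phi1_bounds\<close>). So \<^const>\<open>Phi1\<close> is largest when \<open>n\<close> is divisible by
  high powers of all small primes. With \<open>y = ln n\<close>, the first factor is then about \<open>exp \<gamma> * ln y\<close> by Mertens'
  third theorem, where \<open>\<gamma>\<close> is Euler's constant, and the second about \<open>ln y * ln (ln y)\<close> by Mertens' first theorem. This gives
  \<open>exp \<gamma>\<close> times \<open>(ln (ln n))\<^sup>2 * ln (ln (ln n))\<close>.

  For the upper bound, the prime factors of \<open>n\<close> are split at \<open>y\<close>. Those beyond \<open>y\<close> satisfy
  \<open>(\<Sum>p. ln p) \<le> ln n = y\<close>, and this makes their contribution negligible in both factors
  (\<open>prod_geom_sum_le\<close>, \<open>sum_weights_le\<close>). For the lower bound, \<open>n\<close> runs through the powers \<open>(fact N) ^ k\<close> with \<open>k\<close>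
  about \<open>4 * ln N\<close> (\<open>Phi1_lower\<close>).

  Mertens' first theorem comes from the factorization of \<open>fact n\<close> and the Chebyshev bound on
  primes. The constant in the third theorem is found without evaluating any integral. Group the primes
  into blocks \<open>exp i < p \<le> exp (i + 1)\<close> and let \<open>b i\<close> be the sum of \<open>1 / p\<close> over the block.
  The first theorem implies that \<open>\<Sum>i. b i - 1 / (i + 1)\<close> converges. By Abel's limit theorem the sum is the
  limit of the associated power series at \<open>z = exp (-d)\<close> as \<open>d\<close> tends to 0. There \<open>\<Sum>i. b i * z ^ i\<close> is the prime zeta
  function at \<open>1 + d\<close> up to a factor between 1 and \<open>exp d\<close>, hence \<open>ln (1 / d)\<close> minus the convergent contribution
  \<open>H\<close> of higher prime powers, by the Euler product; and \<open>\<Sum>i. z ^ i / (i + 1)\<close> is \<open>ln (1 / d)\<close> up to \<open>o(1)\<close>. So the sum is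
  \<open>- H\<close> (\<open>block_constant\<close>). Hence \<open>\<Sum>p\<le>exp J. - ln (1 - 1 / p)\<close> is the \<open>J\<close>-th harmonic number up to \<open>o(1)\<close>,
  which is where Euler's constant enters.
\<close>

section \<open>Chebyshev bound for primes\<close>

definition primes_le :: "real \<Rightarrow> nat set" where
  "primes_le x = {p. prime p \<and> real p \<le> x}"

lemma finite_primes_le [simp, intro]: "finite (primes_le x)"
  unfolding primes_le_def
  by (rule finite_subset[of _ "{..nat \<lfloor>x\<rfloor>}"]) (auto simp: le_nat_floor)

lemma primes_leD:
  assumes "p \<in> primes_le x"
  shows "prime p" "real p \<ge> 2" "real p \<le> x"
  using assms prime_ge_2_nat[of p] by (auto simp: primes_le_def)

lemma primes_le_of_nat: "primes_le (real n) = {p. prime p \<and> p \<le> n}"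
  by (auto simp: primes_le_def)

lemma primes_le_floor:
  assumes "x \<ge> 0"
  shows "primes_le x = primes_le (real (nat \<lfloor>x\<rfloor>))"
proof -
  have "real p \<le> x \<longleftrightarrow> p \<le> nat \<lfloor>x\<rfloor>" for p
    using assms by (simp add: le_nat_iff le_floor_iff)
  then show ?thesis by (simp add: primes_le_def)
qed

lemma primes_le_mono: "x \<le> y \<Longrightarrow> primes_le x \<subseteq> primes_le y"
  by (auto simp: primes_le_def)

lemma prod_primes_dvd:
  fixes A :: "nat set"
  assumes "finite A" "\<And>p. p \<in> A \<Longrightarrow> prime p" "\<And>p. p \<in> A \<Longrightarrow> p dvd n"
  shows "\<Prod>A dvd n"
  using assms
proof (induction A rule: finite_induct)
  case (insert p A)
  have "coprime p (\<Prod>A)"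
    using insert.prems insert.hyps by (intro prod_coprime_right) (metis insertCI primes_coprime)
  then show ?case
    using insert by (simp add: divides_mult)
qed auto

lemma odd_central_binomial_le: "(2 * m + 1) choose m \<le> 4 ^ m"
proof -
  have "2 * ((2 * m + 1) choose m) = (\<Sum>k\<in>{m, Suc m}. (2 * m + 1) choose k)"
    using binomial_symmetric[of m "2 * m + 1"] by simp
  also have "\<dots> \<le> (\<Sum>k\<le>2 * m + 1. (2 * m + 1) choose k)"
    by (intro sum_mono2) auto
  also have "\<dots> = 2 * 4 ^ m"
    unfolding choose_row_sum by (simp add: power_mult)
  finally show ?thesis by simp
qed

text \<open>The classical induction: an even \<open>n > 2\<close> is not prime, and for \<open>n = 2 * m + 1\<close> all primes in
  \<open>{m + 2..n}\<close> divide \<open>n choose m\<close>, which is at most \<open>4 ^ m\<close>.\<close>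

lemma primorial_le: "\<Prod>{p::nat. prime p \<and> p \<le> n} \<le> 4 ^ n"
proof (induction n rule: less_induct)
  case (less n)
  consider "n \<le> 1" | "n = 2" | "n > 2" "even n" | m where "n = 2 * m + 1" "m \<ge> 1"
  proof (cases "even n")
    case True
    then show ?thesis using that(1-3) by (cases "n \<le> 2") (auto simp: le_Suc_eq numeral_2_eq_2)
  next
    case False
    then obtain m where "n = 2 * m + 1" by (elim oddE)
    then show ?thesis using that(1,4) by (cases "m = 0") auto
  qed
  then show ?case
  proof cases
    case 1
    then have "{p::nat. prime p \<and> p \<le> n} = {}"
      by (auto dest!: prime_gt_1_nat)
    then show ?thesis by (simp only: prod.empty) simp
  next
    case 2
    have "{p::nat. prime p \<and> p \<le> 2} = {2}"
      by (auto dest: prime_ge_2_nat)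
    then show ?thesis using 2 by simp
  next
    case 3
    have neq: "p \<noteq> n" if "prime p" for p :: nat
      using 3 that primes_dvd_imp_eq[of 2 p] by auto
    have "prime p \<and> p \<le> n \<longleftrightarrow> prime p \<and> p \<le> n - 1" for p :: nat
      using 3 neq[of p] by (cases "prime p"; cases "p \<le> n - 1") auto
    then have "\<Prod>{p::nat. prime p \<and> p \<le> n} \<le> 4 ^ (n - 1)"
      using less.IH[of "n - 1"] 3 by simp
    also have "\<dots> \<le> 4 ^ n" by (intro power_increasing) auto
    finally show ?thesis .
  next
    case 4
    let ?A = "{p::nat. prime p \<and> p \<le> m + 1}" and ?B = "{p::nat. prime p \<and> m + 1 < p \<and> p \<le> 2 * m + 1}"
    have "{p::nat. prime p \<and> p \<le> n} = ?A \<union> ?B" using 4 by auto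
    then have "\<Prod>{p::nat. prime p \<and> p \<le> n} = \<Prod>?A * \<Prod>?B"
      by (simp only:) (rule prod.union_disjoint, auto)
    also have "\<Prod>?B dvd (2 * m + 1) choose m"
    proof (rule prod_primes_dvd)
      fix p assume "p \<in> ?B"
      then have p: "prime p" "m + 1 < p" "p \<le> 2 * m + 1" by auto
      have "fact m * fact (2 * m + 1 - m) * ((2 * m + 1) choose m) = (fact (2 * m + 1) :: nat)"
        by (rule binomial_fact_lemma) auto
      moreover have "p dvd fact (2 * m + 1)" using p prime_dvd_fact_iff by blast
      moreover have "\<not> p dvd fact m" "\<not> p dvd fact (2 * m + 1 - m)"
        using p by (simp_all only: prime_dvd_fact_iff)
      ultimately show "p dvd (2 * m + 1) choose m"
        using p(1) by (metis prime_dvd_mult_iff)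
    qed auto
    then have "\<Prod>?B \<le> 4 ^ m"
      using odd_central_binomial_le[of m] dvd_imp_le[of "\<Prod>?B" "(2 * m + 1) choose m"] by force
    then have "\<Prod>?A * \<Prod>?B \<le> 4 ^ (m + 1) * 4 ^ m"
      using less.IH[of "m + 1"] 4 by (intro mult_mono) auto
    also have "\<dots> = 4 ^ n" using 4 by (simp flip: power_add add: mult_2)
    finally show ?thesis .
  qed
qed

lemma chebyshev_theta_le:
  assumes "x \<ge> 0"
  shows "(\<Sum>p\<in>primes_le x. ln (real p)) \<le> x * ln 4"
proof -
  define n where "n = nat \<lfloor>x\<rfloor>"
  have A: "primes_le x = {p. prime p \<and> p \<le> n}"
    using primes_le_floor[OF assms] by (simp add: n_def primes_le_of_nat)
  have "(\<Sum>p\<in>primes_le x. ln (real p)) = ln (real (\<Prod>(primes_le x)))"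
    by (subst of_nat_prod, subst ln_prod) (auto dest: primes_leD)
  also have "\<dots> \<le> ln (real (4 ^ n))"
    using primorial_le[of n] unfolding A
    by (subst ln_le_cancel_iff)
       (auto simp del: of_nat_power of_nat_prod intro!: prod_pos prime_gt_0_nat)
  also have "\<dots> = n * ln 4" by (simp add: ln_realpow)
  also have "\<dots> \<le> x * ln 4" using assms by (intro mult_right_mono) (auto simp: n_def)
  finally show ?thesis .
qed

section \<open>Mertens' first theorem\<close>

text \<open>Legendre's formula. The upper summation limit \<open>K\<close> is decoupled from \<open>n\<close> so that it stays
  fixed during the induction on \<open>n\<close>; the terms with \<open>p ^ k > n\<close> vanish.\<close>

lemma multiplicity_fact_eq_sum:
  fixes p :: nat
  assumes "prime p" "n \<le> K"
  shows "multiplicity p (fact n) = (\<Sum>k=1..K. n div p ^ k)"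
  using assms(2)
proof (induction n)
  case (Suc n)
  have p: "p \<ge> 2" using assms(1) prime_ge_2_nat by blast
  have "multiplicity p (Suc n) < K + 1"
  proof -
    have "multiplicity p (Suc n) < 2 ^ multiplicity p (Suc n)" by simp
    also have "\<dots> \<le> p ^ multiplicity p (Suc n)" using p by (rule power_mono) simp
    also have "\<dots> \<le> Suc n" by (intro dvd_imp_le multiplicity_dvd) simp
    finally show ?thesis using Suc.prems by simp
  qed
  then have eq: "{k \<in> {1..K}. p ^ k dvd Suc n} = {1..multiplicity p (Suc n)}"
    using p by (subst power_dvd_iff_le_multiplicity) (auto simp: prime_nat_iff)
  have "(\<Sum>k=1..K. Suc n div p ^ k) = (\<Sum>k=1..K. (if p ^ k dvd Suc n then 1 else 0) + n div p ^ k)"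
    by (intro sum.cong) (auto simp: div_Suc dvd_eq_mod_eq_0)
  also have "\<dots> = multiplicity p (Suc n) + (\<Sum>k=1..K. n div p ^ k)"
    using eq by (simp add: sum.distrib flip: sum.inter_filter)
  also have "\<dots> = multiplicity p (Suc n) + multiplicity p (fact n)"
    using Suc by simp
  also have "\<dots> = multiplicity p (fact (Suc n))"
    using assms(1) by (simp only: fact_Suc of_nat_id, subst prime_elem_multiplicity_mult_distrib) auto
  finally show ?case ..
qed auto

lemma multiplicity_fact_ge: "prime (p::nat) \<Longrightarrow> n div p \<le> multiplicity p (fact n)"
  using sum_mono2[of "{1..Suc n}" "{1}" "\<lambda>k. n div p ^ k"]
  by (subst multiplicity_fact_eq_sum[of p n "Suc n"]) auto

lemma multiplicity_fact_le:
  assumes "prime (p::nat)"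
  shows "real (multiplicity p (fact n)) \<le> real n / (real p - 1)"
proof -
  have p: "real p \<ge> 2" using prime_ge_2_nat[OF assms] by simp
  have geo: "(\<Sum>k=1..K. 1 / real p ^ k) = (1 - 1 / real p ^ K) / (real p - 1)" for K
    using p by (induction K) (auto simp: divide_simps, auto simp: algebra_simps)
  have "real (multiplicity p (fact n)) = (\<Sum>k=1..n. real (n div p ^ k))"
    by (subst multiplicity_fact_eq_sum[OF assms order.refl]) simp
  also have "\<dots> \<le> (\<Sum>k=1..n. real n * (1 / real p ^ k))"
    using of_nat_div_le_of_nat[where ?'a = real] by (intro sum_mono) (simp flip: of_nat_power)
  also have "\<dots> = real n * ((1 - 1 / real p ^ n) / (real p - 1))"
    by (simp only: sum_distrib_left[symmetric] geo)
  also have "\<dots> \<le> real n * (1 / (real p - 1))"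
    using p by (intro mult_left_mono divide_right_mono) auto
  finally show ?thesis by simp
qed

lemma ln_fact_eq_sum_primes:
  "ln (fact n :: real) = (\<Sum>p\<in>primes_le n. real (multiplicity p (fact n :: nat)) * ln (real p))"
proof -
  have P: "prime_factors (fact n :: nat) = primes_le n"
    by (auto simp: prime_factors_fact primes_le_def dest: prime_ge_2_nat)
  have "(fact n :: nat) = (\<Prod>p\<in>primes_le n. p ^ multiplicity p (fact n))"
    using prod_prime_factors[of "fact n :: nat"] by (simp add: P)
  then have "(fact n :: real) = (\<Prod>p\<in>primes_le n. real p ^ multiplicity p (fact n :: nat))"
    by (metis (no_types, lifting) of_nat_fact of_nat_power of_nat_prod prod.cong)
  then show ?thesis
    by (simp only:) (subst ln_prod, auto simp: ln_realpow dest: primes_leD intro!: sum.cong)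
qed

lemma ln_fact_bounds: "real n * ln (real n) - real n \<le> ln (fact n :: real)"
  "ln (fact n :: real) \<le> real n * ln (real n)"
proof -
  show "real n * ln (real n) - real n \<le> ln (fact n :: real)"
  proof (induction n)
    case (Suc n)
    \<comment> \<open>The increment of \<open>x * ln x - x\<close> from \<open>n\<close> to \<open>n + 1\<close> is at most \<open>ln (n + 1)\<close>.\<close>
    have "real n * (ln (real n + 1) - ln (real n)) \<le> 1"
    proof (cases "n = 0")
      case False
      then have "ln (real n + 1) - ln (real n) = ln (1 + 1 / real n)"
        by (subst ln_divide_pos[symmetric]) (auto simp: field_simps)
      also have "\<dots> \<le> 1 / real n"
        by (rule ln_add_one_self_le_self) simp
      finally show ?thesis using False by (simp add: field_simps)
    qed simp
    moreover have "ln (fact (Suc n) :: real) = ln (real n + 1) + ln (fact n)"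
      by (simp add: ln_mult add_ac)
    ultimately show ?case using Suc by (simp add: algebra_simps)
  qed simp
  have "ln (fact n :: real) \<le> ln (real n ^ n)"
    using fact_le_power[of n, where ?'a = real] by (cases "n = 0") auto
  then show "ln (fact n :: real) \<le> real n * ln (real n)"
    by (cases "n = 0") (auto simp: ln_realpow)
qed

lemma summable_ln_gap: "summable (\<lambda>n::nat. ln (real n) / (real n * (real n - 1)))"
proof (rule summable_comparison_test_bigo)
  show "summable (\<lambda>n. norm (real n powr (-3/2)))"
    by (simp add: summable_real_powr_iff)
  show "(\<lambda>n::nat. ln (real n) / (real n * (real n - 1))) \<in> O(\<lambda>n. real n powr (-3/2))"
    by real_asymp
qed

lemma sum_ln_gap_bounded:
  obtains K where "K \<ge> 0" "\<And>x. (\<Sum>p\<in>primes_le x. ln (real p) / (real p * (real p - 1))) \<le> K"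
proof
  let ?f = "\<lambda>n::nat. ln (real n) / (real n * (real n - 1))"
  have nonneg: "?f n \<ge> 0" for n
    by (cases "n = 0") auto
  show "suminf ?f \<ge> 0"
    by (intro suminf_nonneg summable_ln_gap nonneg)
  show "sum ?f (primes_le x) \<le> suminf ?f" for x
    by (intro sum_le_suminf summable_ln_gap) (auto simp: nonneg)
qed

text \<open>Factoring \<open>fact n\<close> by Legendre's formula gives \<open>ln (fact n)\<close> as a sum over primes, up to errors
  controlled by the Chebyshev bound, while \<open>ln (fact n) = n * ln n + O(n)\<close>. The versions with
  \<open>p - 1\<close> and \<open>p + 1\<close> in place of \<open>p\<close> differ from it by a convergent series; they are the ones that the
  bounds on \<^const>\<open>Phi1\<close> call for.\<close>

theorem mertens_first:
  obtains C where "C \<ge> 0"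
    "\<And>x. x \<ge> 1 \<Longrightarrow> \<bar>(\<Sum>p\<in>primes_le x. ln (real p) / real p) - ln x\<bar> \<le> C"
    "\<And>x. x \<ge> 1 \<Longrightarrow> (\<Sum>p\<in>primes_le x. ln (real p) / (real p - 1)) \<le> ln x + C"
    "\<And>x. x \<ge> 1 \<Longrightarrow> ln x - C \<le> (\<Sum>p\<in>primes_le x. ln (real p) / (real p + 1))"
proof -
  obtain K where K: "K \<ge> 0" "\<And>x. (\<Sum>p\<in>primes_le x. ln (real p) / (real p * (real p - 1))) \<le> K"
    using sum_ln_gap_bounded by blast
  have gap: "(\<Sum>p\<in>primes_le x. ln (real p) / (real p - 1)) - (\<Sum>p\<in>primes_le x. ln (real p) / real p) \<le> K" for x
    using K(2)[of x] by (subst sum_subtractf[symmetric])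
      (auto dest!: primes_leD(2) simp: field_simps intro!: order.trans[OF sum_mono K(2)[of x]])
  have gap': "(\<Sum>p\<in>primes_le x. ln (real p) / real p) - (\<Sum>p\<in>primes_le x. ln (real p) / (real p + 1)) \<le> K" for x
  proof -
    have "(\<Sum>p\<in>primes_le x. ln (real p) / real p) - (\<Sum>p\<in>primes_le x. ln (real p) / (real p + 1))
        = (\<Sum>p\<in>primes_le x. ln (real p) / (real p * (real p + 1)))"
    proof (subst sum_subtractf[symmetric], intro sum.cong refl)
      fix p assume "p \<in> primes_le x"
      then have "real p + 1 \<noteq> 0" "real p \<noteq> 0" using primes_leD(2)[of p x] by auto
      then show "ln (real p) / real p - ln (real p) / (real p + 1) = ln (real p) / (real p * (real p + 1))"
        by (simp add: divide_simps) (simp add: algebra_simps)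
    qed
    also have "\<dots> \<le> (\<Sum>p\<in>primes_le x. ln (real p) / (real p * (real p - 1)))"
      by (intro sum_mono divide_left_mono mult_left_mono mult_pos_pos) (auto dest!: primes_leD(2))
    finally show ?thesis using K(2)[of x] by linarith
  qed
  have main: "ln x - (1 + K + ln 2) \<le> (\<Sum>p\<in>primes_le x. ln (real p) / real p)"
    "(\<Sum>p\<in>primes_le x. ln (real p) / real p) \<le> ln x + ln 4" if "x \<ge> 1" for x
  proof -
    define n where "n = nat \<lfloor>x\<rfloor>"
    have n: "n \<ge> 1" "real n \<le> x" "x \<le> 2 * real n"
    proof -
      have "1 \<le> \<lfloor>x\<rfloor>" using that by simp
      then have "1 \<le> real_of_int \<lfloor>x\<rfloor>" by linarith
      moreover have "real n = real_of_int \<lfloor>x\<rfloor>" using that by (simp add: n_def)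
      ultimately show "n \<ge> 1" "real n \<le> x" "x \<le> 2 * real n" by linarith+
    qed
    have P: "primes_le x = primes_le n"
      unfolding n_def using that by (intro primes_le_floor) simp
    have "real n * ln (real n) - real n \<le> ln (fact n :: real)" by (rule ln_fact_bounds)
    also have "\<dots> \<le> (\<Sum>p\<in>primes_le x. real n / (real p - 1) * ln (real p))"
      unfolding ln_fact_eq_sum_primes P
      by (intro sum_mono mult_right_mono multiplicity_fact_le) (auto dest: primes_leD)
    also have "\<dots> = real n * (\<Sum>p\<in>primes_le x. ln (real p) / (real p - 1))"
      by (simp add: sum_distrib_left)
    finally have "real n * (ln (real n) - 1) \<le> real n * (\<Sum>p\<in>primes_le x. ln (real p) / (real p - 1))"
      by (simp add: algebra_simps)
    then have "ln (real n) - 1 \<le> (\<Sum>p\<in>primes_le x. ln (real p) / (real p - 1))"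
      using n by simp
    moreover have "ln x \<le> ln (2 * real n)" using n that by (subst ln_le_cancel_iff) auto
    moreover have "ln (2 * real n) = ln 2 + ln (real n)" using n by (simp add: ln_mult)
    ultimately show "ln x - (1 + K + ln 2) \<le> (\<Sum>p\<in>primes_le x. ln (real p) / real p)"
      using gap[of x] by linarith
    have "(\<Sum>p\<in>primes_le x. (real n / real p - 1) * ln (real p)) \<le> ln (fact n :: real)"
      unfolding ln_fact_eq_sum_primes P
    proof (intro sum_mono mult_right_mono)
      fix p assume p: "p \<in> primes_le (real n)"
      have "real n / real p - 1 \<le> real (n div p)"
        using real_of_int_div3[of "int n" "int p"] by (simp flip: of_nat_div)
      also have "\<dots> \<le> real (multiplicity p (fact n :: nat))"
        using multiplicity_fact_ge primes_leD(1)[OF p] by simp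
      finally show "real n / real p - 1 \<le> real (multiplicity p (fact n :: nat))" .
    qed (auto dest: primes_leD)
    also have "\<dots> \<le> real n * ln (real n)" by (rule ln_fact_bounds)
    also have "(\<Sum>p\<in>primes_le x. (real n / real p - 1) * ln (real p)) =
        real n * (\<Sum>p\<in>primes_le x. ln (real p) / real p) - (\<Sum>p\<in>primes_le x. ln (real p))"
      by (simp add: algebra_simps sum_subtractf sum_distrib_left)
    finally have "real n * (\<Sum>p\<in>primes_le x. ln (real p) / real p) - (\<Sum>p\<in>primes_le x. ln (real p))
        \<le> real n * ln (real n)" .
    moreover have "(\<Sum>p\<in>primes_le x. ln (real p)) \<le> real n * ln 4"
      unfolding P by (rule chebyshev_theta_le) simp
    ultimately have "real n * (\<Sum>p\<in>primes_le x. ln (real p) / real p) \<le> real n * (ln (real n) + ln 4)"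
      by (simp add: algebra_simps)
    then have "(\<Sum>p\<in>primes_le x. ln (real p) / real p) \<le> ln (real n) + ln 4"
      using n by simp
    moreover have "ln (real n) \<le> ln x" using n by simp
    ultimately show "(\<Sum>p\<in>primes_le x. ln (real p) / real p) \<le> ln x + ln 4" by linarith
  qed
  show ?thesis
  proof (rule that[of "1 + 2 * K + ln 2 + ln 4"])
    fix x :: real assume x: "x \<ge> 1"
    have pos: "ln 2 > (0::real)" "ln 4 > (0::real)" by auto
    show "\<bar>(\<Sum>p\<in>primes_le x. ln (real p) / real p) - ln x\<bar> \<le> 1 + 2 * K + ln 2 + ln 4"
      using main[OF x] K(1) pos by linarith
    show "(\<Sum>p\<in>primes_le x. ln (real p) / (real p - 1)) \<le> ln x + (1 + 2 * K + ln 2 + ln 4)"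
      using main[OF x] K(1) pos gap[of x] by linarith
    show "ln x - (1 + 2 * K + ln 2 + ln 4) \<le> (\<Sum>p\<in>primes_le x. ln (real p) / (real p + 1))"
      using main[OF x] K(1) pos gap'[of x] by linarith
  qed (use K in auto)
qed

section \<open>Abel's limit theorem and a convergence test\<close>

text \<open>Summation by parts rewrites the power series as \<open>L + (1 - z) * (\<Sum>n. t (Suc n) * z ^ n)\<close>, where
  \<open>t n \<longlonglongrightarrow> 0\<close> is the error of the \<open>n\<close>-th partial sum. The finitely many large \<open>t n\<close> are killed by
  the factor \<open>1 - z\<close>, and the others contribute at most \<open>\<epsilon>\<close> because \<open>(1 - z) * (\<Sum>n. z ^ n) = 1\<close>.\<close>

lemma abel_limit:
  fixes a :: "nat \<Rightarrow> real"
  assumes "a sums L"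
  shows "((\<lambda>z. \<Sum>n. a n * z ^ n) \<longlongrightarrow> L) (at_left 1)"
    and "\<And>z. 0 \<le> z \<Longrightarrow> z < 1 \<Longrightarrow> summable (\<lambda>n. a n * z ^ n)"
proof -
  define t where "t n = (\<Sum>k<n. a k) - L" for n
  have t0: "t \<longlonglongrightarrow> 0"
    using assms unfolding t_def sums_def by (simp add: LIM_zero)
  then obtain B where B: "\<And>n. \<bar>t n\<bar> \<le> B"
    by (metis Bseq_def convergentI convergent_imp_Bseq real_norm_def)
  have B0: "B \<ge> 0" using B[of 0] by linarith
  have summ: "summable (\<lambda>n. \<bar>t (Suc n)\<bar> * z ^ n)" if "0 \<le> z" "z < 1" for z
  proof (rule summable_comparison_test')
    show "summable (\<lambda>n. B * z ^ n)" using that by (intro summable_mult summable_geometric) auto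
  qed (use that B in \<open>auto simp: abs_mult intro!: mult_right_mono\<close>)
  have fin: "(\<Sum>n<M. a n * z ^ n) = L + (1 - z) * (\<Sum>n<M. t (Suc n) * z ^ n) + z ^ M * t M" for M z
    by (induction M) (auto simp: t_def algebra_simps)
  have summ': "summable (\<lambda>n. t (Suc n) * z ^ n)" if "0 \<le> z" "z < 1" for z
    using summ[OF that] that by (intro summable_rabs_cancel[of "\<lambda>n. t (Suc n) * z ^ n"]) (simp add: abs_mult)
  have lim: "(\<lambda>n. a n * z ^ n) sums (L + (1 - z) * (\<Sum>n. t (Suc n) * z ^ n) + 0 * 0)"
    if "0 \<le> z" "z < 1" for z
    unfolding sums_def fin using that
    by (intro tendsto_intros t0 summable_LIMSEQ summ' LIMSEQ_realpow_zero)
  show "summable (\<lambda>n. a n * z ^ n)" if "0 \<le> z" "z < 1" for z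
    using lim[OF that] by (simp add: sums_iff)
  show "((\<lambda>z. \<Sum>n. a n * z ^ n) \<longlongrightarrow> L) (at_left 1)"
  proof (rule tendstoI)
    fix e :: real assume e: "e > 0"
    obtain N where N: "\<And>n. n \<ge> N \<Longrightarrow> \<bar>t n\<bar> \<le> e / 2"
      using LIMSEQ_D[OF t0, of "e / 2"] e by (auto intro: less_imp_le)
    have "((\<lambda>z::real. (1 - z) * (real N * B)) \<longlongrightarrow> (1 - 1) * (real N * B)) (at_left 1)"
      by (intro tendsto_intros)
    then have "\<forall>\<^sub>F z::real in at_left 1. (1 - z) * (real N * B) < e / 2"
      using e by (intro order_tendstoD(2)[where a = "e / 2"]) auto
    moreover have "\<forall>\<^sub>F z::real in at_left 1. 0 \<le> z \<and> z < 1"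
      unfolding eventually_at_left_field by (intro exI[of _ 0]) auto
    ultimately show "\<forall>\<^sub>F z in at_left 1. dist (\<Sum>n. a n * z ^ n) L < e"
    proof eventually_elim
      case (elim z)
      then have z: "0 \<le> z" "z < 1" by auto
      have "\<bar>\<Sum>n. t (Suc n) * z ^ n\<bar> \<le> (\<Sum>n. \<bar>t (Suc n)\<bar> * z ^ n)"
        using summable_rabs[of "\<lambda>n. t (Suc n) * z ^ n"] summ[OF z] z by (simp add: abs_mult)
      also have "\<dots> \<le> (\<Sum>n. (if n < N then B else 0) + e / 2 * z ^ n)"
      proof (rule suminf_le)
        fix n
        have "z ^ n \<le> 1" using z by (intro power_le_one) auto
        then have "\<bar>t (Suc n)\<bar> * z ^ n \<le> B * 1" using B B0 z by (intro mult_mono) auto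
        moreover have "\<bar>t (Suc n)\<bar> * z ^ n \<le> e / 2 * z ^ n" if "n \<ge> N"
          using N[of "Suc n"] that z by (intro mult_right_mono) auto
        ultimately show "\<bar>t (Suc n)\<bar> * z ^ n \<le> (if n < N then B else 0) + e / 2 * z ^ n"
          using e z by (auto intro: add_increasing2)
      qed (use z summ[OF z] in \<open>auto intro!: summable_add summable_mult summable_geometric\<close>)
      also have "\<dots> = real N * B + e / 2 * (1 / (1 - z))"
      proof -
        have "(\<lambda>n. if n < N then B else 0) sums (\<Sum>n<N. B)"
          using sums_If_finite_set[of "{..<N}" "\<lambda>_. B"] by simp
        moreover have "(\<lambda>n. e / 2 * z ^ n) sums (e / 2 * (1 / (1 - z)))"
          using z by (intro sums_mult geometric_sums) auto
        ultimately show ?thesis by (simp add: sums_add sums_unique[symmetric])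
      qed
      finally have "(1 - z) * \<bar>\<Sum>n. t (Suc n) * z ^ n\<bar> \<le> (1 - z) * (real N * B + e / 2 * (1 / (1 - z)))"
        using z by (intro mult_left_mono) auto
      also have "\<dots> = (1 - z) * (real N * B) + e / 2" using z by (simp add: divide_simps) (simp add: algebra_simps)
      finally have "(1 - z) * \<bar>\<Sum>n. t (Suc n) * z ^ n\<bar> < e" using elim by linarith
      moreover have "(\<Sum>n. a n * z ^ n) - L = (1 - z) * (\<Sum>n. t (Suc n) * z ^ n)"
        using sums_unique[OF lim[OF z]] by simp
      ultimately show ?case using z by (simp add: dist_real_def abs_mult)
    qed
  qed
qed

text \<open>Dirichlet's test for the weights \<open>1 / (i + 1)\<close>: after summation by parts the general term is the
  bounded partial sum divided by \<open>(i + 1) * (i + 2)\<close>.\<close>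

lemma summable_over_index_of_bounded_partial_sums:
  fixes d :: "nat \<Rightarrow> real"
  assumes "\<And>n. \<bar>\<Sum>i<n. d i\<bar> \<le> C"
  shows "summable (\<lambda>i. d i / (real i + 1))"
proof -
  define T where "T n = (\<Sum>i<n. d i)" for n
  have bound: "\<bar>T n\<bar> \<le> C" for n using assms by (simp add: T_def)
  \<comment> \<open>Abel summation, in the form suited to induction on \<open>n\<close>.\<close>
  have parts: "(\<Sum>i<n. d i / (real i + 1)) = T n / (real n + 1) + (\<Sum>i<n. T (Suc i) / ((real i + 1) * (real i + 2)))" for n
  proof (induction n)
    case (Suc n)
    have "d n = T (Suc n) - T n" by (simp add: T_def)
    moreover have "T (Suc n) / (real n + 1) = T (Suc n) / (real (Suc n) + 1) + T (Suc n) / ((real n + 1) * (real n + 2))"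
      by (simp add: divide_simps) (simp add: algebra_simps)
    ultimately show ?case using Suc by (simp add: diff_divide_distrib)
  qed (simp add: T_def)
  have "(\<lambda>n. T n / (real n + 1)) \<longlonglongrightarrow> 0"
  proof (rule Lim_null_comparison)
    show "\<forall>\<^sub>F n in sequentially. norm (T n / (real n + 1)) \<le> C / (real n + 1)"
      using bound by (auto intro!: always_eventually divide_right_mono)
    show "(\<lambda>n. C / (real n + 1)) \<longlonglongrightarrow> 0" by real_asymp
  qed
  moreover have "summable (\<lambda>i. T (Suc i) / ((real i + 1) * (real i + 2)))"
  proof (rule summable_comparison_test')
    show "summable (\<lambda>i. C * (1 / ((real i + 1) * (real i + 2))))"
    proof (intro summable_mult, rule summable_comparison_test_bigo)
      show "summable (\<lambda>n. norm (real n powr (-2)))" by (simp add: summable_real_powr_iff)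
      show "(\<lambda>i::nat. 1 / ((real i + 1) * (real i + 2))) \<in> O(\<lambda>n. real n powr (-2))" by real_asymp
    qed
  qed (use bound in \<open>auto simp: abs_mult divide_simps\<close>)
  ultimately show ?thesis
    unfolding summable_iff_convergent parts
    by (intro convergent_add) (auto simp: convergent_def summable_iff_convergent[symmetric])
qed

section \<open>Reciprocals of primes in exponential blocks\<close>

text \<open>Grouping the primes by \<open>\<lfloor>ln p\<rfloor>\<close> turns sums over primes into series indexed by the natural
  numbers. On a block, \<open>ln p\<close> is known up to an error of 1, which is precise enough for everything below.\<close>

definition prime_block :: "nat \<Rightarrow> nat set" where
  "prime_block i = primes_le (exp (real (Suc i))) - primes_le (exp (real i))"

lemma finite_prime_block [simp, intro]: "finite (prime_block i)"
  by (simp add: prime_block_def)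

lemma prime_blockD:
  assumes "p \<in> prime_block i"
  shows "prime p" "real p \<ge> 2" "real i < ln (real p)" "ln (real p) \<le> real i + 1"
proof -
  show p: "prime p" "real p \<ge> 2"
    using assms primes_leD by (auto simp: prime_block_def)
  have *: "exp (real i) < real p" "real p \<le> exp (real i + 1)"
    using assms by (auto simp: prime_block_def primes_le_def add_ac)
  show "real i < ln (real p)" "ln (real p) \<le> real i + 1"
    using * p ln_le_cancel_iff[of "real p" "exp (real i + 1)"] ln_less_cancel_iff[of "exp (real i)" "real p"] by auto
qed

lemma primes_le_exp_0: "primes_le (exp (real 0)) = {}"
proof -
  have False if "p \<in> primes_le (exp (real 0))" for p
    using primes_leD(2,3)[OF that] by simp
  then show ?thesis by blast
qed

lemma sum_prime_blocks:
  fixes f :: "nat \<Rightarrow> real"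
  shows "(\<Sum>p\<in>primes_le (exp (real n)). f p) = (\<Sum>i<n. \<Sum>p\<in>prime_block i. f p)"
proof (induction n)
  case (Suc n)
  have "primes_le (exp (real n)) \<subseteq> primes_le (exp (real (Suc n)))"
    by (intro primes_le_mono) simp
  then have "(\<Sum>p\<in>primes_le (exp (real (Suc n))). f p) = (\<Sum>p\<in>primes_le (exp (real n)). f p) + (\<Sum>p\<in>prime_block n. f p)"
    unfolding prime_block_def by (subst sum_diff) auto
  then show ?case using Suc by simp
qed (simp only: primes_le_exp_0, simp)

definition block_recip :: "nat \<Rightarrow> real" where
  "block_recip i = (\<Sum>p\<in>prime_block i. 1 / real p)"

text \<open>By Mertens' first theorem the block sums \<open>c i\<close> of \<open>ln p / p\<close> have mean 1 with bounded discrepancy, and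
  \<open>block_recip i\<close> lies between \<open>c i / (i + 1)\<close> and \<open>c i / i\<close>. So \<open>(c i - 1) / (i + 1)\<close> is summable by the
  preceding test, and the remaining error is \<open>O(1 / i\<^sup>2)\<close>.\<close>

lemma summable_block_recip_minus_harmonic: "summable (\<lambda>i. block_recip i - 1 / (real i + 1))"
proof -
  obtain C where C: "C \<ge> 0" "\<And>x. x \<ge> 1 \<Longrightarrow> \<bar>(\<Sum>p\<in>primes_le x. ln (real p) / real p) - ln x\<bar> \<le> C"
    using mertens_first by metis
  define c where "c i = (\<Sum>p\<in>prime_block i. ln (real p) / real p)" for i
  have T: "\<bar>\<Sum>i<n. c i - 1\<bar> \<le> C" for n
    using C(2)[of "exp (real n)"] by (simp add: c_def sum_subtractf sum_prime_blocks)
  have S1: "summable (\<lambda>i. (c i - 1) / (real i + 1))"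
    by (rule summable_over_index_of_bounded_partial_sums) (rule T)
  have c_le: "c i \<le> 1 + 2 * C" for i
    using T[of i] T[of "Suc i"] by simp
  have low: "c i / (real i + 1) \<le> block_recip i" for i
    unfolding c_def block_recip_def sum_divide_distrib
    by (intro sum_mono) (use prime_blockD[of _ i] in \<open>auto simp: divide_simps\<close>)
  have up: "block_recip i \<le> c i / real i" if "i > 0" for i
    unfolding c_def block_recip_def sum_divide_distrib
  proof (intro sum_mono)
    fix p assume "p \<in> prime_block i"
    from prime_blockD[OF this] that show "1 / real p \<le> ln (real p) / real p / real i"
      by (simp add: divide_simps)
  qed
  have S2: "summable (\<lambda>i. block_recip i - c i / (real i + 1))"
  proof (rule summable_comparison_test')
    show "summable (\<lambda>i. (1 + 2 * C) * (1 / (real i * (real i + 1))))"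
    proof (intro summable_mult, rule summable_comparison_test_bigo)
      show "summable (\<lambda>n. norm (real n powr (-2)))" by (simp add: summable_real_powr_iff)
      show "(\<lambda>i::nat. 1 / (real i * (real i + 1))) \<in> O(\<lambda>n. real n powr (-2))" by real_asymp
    qed
    fix i :: nat assume i: "i \<ge> 1"
    have "block_recip i - c i / (real i + 1) \<le> c i * (1 / (real i * (real i + 1)))"
    proof -
      have "c i * (1 / (real i * (real i + 1))) = c i / real i - c i / (real i + 1)"
        using i by (simp add: divide_simps) (simp add: algebra_simps)
      then show ?thesis using up[of i] i by simp
    qed
    also have "\<dots> \<le> (1 + 2 * C) * (1 / (real i * (real i + 1)))"
      using c_le by (intro mult_right_mono) auto
    finally show "norm (block_recip i - c i / (real i + 1)) \<le> (1 + 2 * C) * (1 / (real i * (real i + 1)))"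
      using low[of i] by simp
  qed
  from summable_add[OF S1 S2] show ?thesis
    by (simp add: diff_divide_distrib)
qed

section \<open>Finite Euler products\<close>

text \<open>The number whose prime factorization is given by the exponents \<open>\<mu>\<close> on the set \<open>P\<close> of primes.\<close>

definition smooth_number :: "nat set \<Rightarrow> (nat \<Rightarrow> nat) \<Rightarrow> nat" where
  "smooth_number P \<mu> = (\<Prod>p\<in>P. p ^ \<mu> p)"

lemma inj_on_smooth_number:
  assumes "finite P" "\<And>p. p \<in> P \<Longrightarrow> prime p"
  shows "inj_on (smooth_number P) (PiE P B)"
proof (rule inj_onI)
  fix \<mu> \<nu> assume *: "\<mu> \<in> PiE P B" "\<nu> \<in> PiE P B" "smooth_number P \<mu> = smooth_number P \<nu>"
  show "\<mu> = \<nu>"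
  proof (rule PiE_ext[OF *(1,2)])
    fix p assume p: "p \<in> P"
    then show "\<mu> p = \<nu> p"
      using arg_cong[OF *(3), of "multiplicity p"] assms
      by (simp add: smooth_number_def multiplicity_prod_prime_powers)
  qed
qed

text \<open>Truncating the geometric series at \<open>K\<close> keeps both sides finite, so that unique factorization is the
  only ingredient.\<close>

lemma finite_euler_product:
  assumes "finite P" "\<And>p. p \<in> P \<Longrightarrow> prime p"
  shows "(\<Prod>p\<in>P. \<Sum>k\<le>K. (real p powr s) ^ k) = (\<Sum>n\<in>smooth_number P ` (P \<rightarrow>\<^sub>E {..K}). real n powr s)"
proof -
  have "(\<Prod>p\<in>P. \<Sum>k\<le>K. (real p powr s) ^ k) = (\<Sum>\<mu>\<in>P \<rightarrow>\<^sub>E {..K}. \<Prod>p\<in>P. (real p powr s) ^ \<mu> p)"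
    using assms by (intro prod_sum_PiE) auto
  also have "\<dots> = (\<Sum>\<mu>\<in>P \<rightarrow>\<^sub>E {..K}. real (smooth_number P \<mu>) powr s)"
  proof (intro sum.cong refl)
    fix \<mu> :: "nat \<Rightarrow> nat"
    have "(real p powr s) ^ \<mu> p = (real p ^ \<mu> p) powr s" if "p \<in> P" for p
      using prime_gt_0_nat[OF assms(2)[OF that]]
      by (simp add: powr_powr powr_realpow[symmetric] mult.commute)
    then show "(\<Prod>p\<in>P. (real p powr s) ^ \<mu> p) = real (smooth_number P \<mu>) powr s"
      by (simp add: smooth_number_def prod_powr_distrib)
  qed
  also have "\<dots> = (\<Sum>n\<in>smooth_number P ` (P \<rightarrow>\<^sub>E {..K}). real n powr s)"
    by (subst sum.reindex[OF inj_on_smooth_number[OF assms]]) auto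
  finally show ?thesis .
qed

text \<open>The mean value theorem for \<open>x powr (-d) / d\<close>; these bounds replace the integral test in the estimate of
  the zeta function.\<close>

lemma powr_telescope_bounds:
  fixes d x :: real
  assumes "d > 0" "x > 0"
  shows "(x powr (-d) - (x + 1) powr (-d)) / d \<le> x powr (-1 - d)"
    and "(x + 1) powr (-1 - d) \<le> (x powr (-d) - (x + 1) powr (-d)) / d"
proof -
  have e: "- 1 - d = - d - 1" by simp
  have "\<exists>z>x. z < x + 1 \<and> - ((x + 1) powr (-d)) / d - (- (x powr (-d)) / d) = (x + 1 - x) * (z powr (- d - 1))"
    using assms by (intro MVT2) (auto intro!: derivative_eq_intros simp: algebra_simps)
  then obtain z where z: "z > x" "z < x + 1" "(x powr (-d) - (x + 1) powr (-d)) / d = z powr (- d - 1)"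
    by (auto simp: diff_divide_distrib)
  show "(x powr (-d) - (x + 1) powr (-d)) / d \<le> x powr (-1 - d)"
    unfolding z e using z assms by (intro powr_mono2') auto
  show "(x + 1) powr (-1 - d) \<le> (x powr (-d) - (x + 1) powr (-d)) / d"
    unfolding z e using z assms by (intro powr_mono2') auto
qed

lemma zeta_partial_sum_bounds:
  fixes d :: real
  assumes "d > 0"
  shows "(1 - (real N + 1) powr (-d)) / d \<le> (\<Sum>n=1..N. real n powr (-1 - d))"
    and "(\<Sum>n=1..N. real n powr (-1 - d)) \<le> 1 + 1 / d"
proof -
  show "(1 - (real N + 1) powr (-d)) / d \<le> (\<Sum>n=1..N. real n powr (-1 - d))"
  proof (induction N)
    case (Suc N)
    then show ?case
      using powr_telescope_bounds(1)[OF assms, of "real (Suc N)"] by (simp add: diff_divide_distrib add_ac)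
  qed simp
  have "(\<Sum>n=1..Suc M. real n powr (-1 - d)) \<le> 1 + (1 - real (Suc M) powr (-d)) / d" for M
  proof (induction M)
    case (Suc M)
    then show ?case
      using powr_telescope_bounds(2)[OF assms, of "real (Suc M)"] by (simp add: diff_divide_distrib add_ac)
  qed simp
  also have "1 + (1 - real (Suc M) powr (-d)) / d \<le> 1 + 1 / d" for M
    using assms by (simp add: divide_right_mono)
  finally have "(\<Sum>n=1..Suc M. real n powr (-1 - d)) \<le> 1 + 1 / d" for M .
  then show "(\<Sum>n=1..N. real n powr (-1 - d)) \<le> 1 + 1 / d"
    using assms by (cases N) (simp, metis)
qed

text \<open>Every \<open>n \<le> N\<close> is a product of primes up to \<open>N\<close> with exponents at most \<open>N\<close>, which gives the lower bound.
  The upper bound holds for every truncation of the geometric series and hence for their limit.\<close>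

lemma euler_product_bounds:
  fixes d :: real
  assumes "d > 0"
  shows "(\<Sum>n=1..N. real n powr (-1 - d)) \<le> (\<Prod>p\<in>primes_le (real N). 1 / (1 - real p powr (-1 - d)))"
    and "(\<Prod>p\<in>primes_le (real N). 1 / (1 - real p powr (-1 - d))) \<le> 1 + 1 / d"
proof -
  let ?P = "primes_le (real N)" and ?x = "\<lambda>p::nat. real p powr (-1 - d)"
  have x: "0 < ?x p" "?x p < 1" if "p \<in> ?P" for p
    using primes_leD[OF that] assms powr_less_mono2_neg[of "-1 - d" 1 "real p"] by auto
  have fep: "(\<Prod>p\<in>?P. \<Sum>k\<le>K. ?x p ^ k) = (\<Sum>n\<in>smooth_number ?P ` (?P \<rightarrow>\<^sub>E {..K}). ?x n)" for K
    by (intro finite_euler_product) (auto dest: primes_leD)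
  have fin: "finite (smooth_number ?P ` (?P \<rightarrow>\<^sub>E {..K}))" for K
    by (intro finite_imageI finite_PiE) auto
  have geo: "(\<lambda>K. \<Sum>k\<le>K. ?x p ^ k) \<longlonglongrightarrow> 1 / (1 - ?x p)" if "p \<in> ?P" for p
    using geometric_sums[of "?x p"] x[OF that] unfolding sums_def_le by simp
  have "(\<Sum>n=1..N. ?x n) \<le> (\<Sum>n\<in>smooth_number ?P ` (?P \<rightarrow>\<^sub>E {..N}). ?x n)"
  proof (intro sum_mono2 fin subsetI)
    fix n assume n: "n \<in> {1..N}"
    \<comment> \<open>The exponents are bounded by \<open>N\<close> since \<open>2 ^ m > m\<close>.\<close>
    define \<mu> where "\<mu> = restrict (\<lambda>p. multiplicity p n) ?P"
    have "multiplicity p n \<le> N" if "p \<in> ?P" for p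
    proof -
      have "multiplicity p n < 2 ^ multiplicity p n" by simp
      also have "\<dots> \<le> p ^ multiplicity p n" using primes_leD(2)[OF that] by (intro power_mono) auto
      also have "\<dots> \<le> n" using n by (intro dvd_imp_le multiplicity_dvd) auto
      finally show ?thesis using n by simp
    qed
    then have "\<mu> \<in> ?P \<rightarrow>\<^sub>E {..N}" by (auto simp: \<mu>_def)
    moreover have "smooth_number ?P \<mu> = n"
    proof -
      have "smooth_number ?P \<mu> = (\<Prod>p\<in>?P. p ^ multiplicity p n)"
        unfolding smooth_number_def \<mu>_def by (intro prod.cong) auto
      also have "\<dots> = (\<Prod>p\<in>prime_factors n. p ^ multiplicity p n)"
      proof (intro prod.mono_neutral_right ballI)
        have "p \<le> N" if "p \<in> prime_factors n" for p
          using dvd_imp_le[OF in_prime_factors_imp_dvd[OF that]] n by simp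
        then show "prime_factors n \<subseteq> ?P" by (auto simp: primes_le_def)
      qed (auto simp: prime_factors_multiplicity dest: primes_leD)
      also have "\<dots> = n" using n prod_prime_factors[of n] by simp
      finally show ?thesis .
    qed
    ultimately show "n \<in> smooth_number ?P ` (?P \<rightarrow>\<^sub>E {..N})" by blast
  qed auto
  also have "\<dots> = (\<Prod>p\<in>?P. \<Sum>k\<le>N. ?x p ^ k)" by (rule fep[symmetric])
  also have "\<dots> \<le> (\<Prod>p\<in>?P. 1 / (1 - ?x p))"
  proof (intro prod_mono conjI)
    fix p assume p: "p \<in> ?P"
    show "(\<Sum>k\<le>N. ?x p ^ k) \<le> 1 / (1 - ?x p)"
      using geometric_sums[of "?x p"] x[OF p] sum_le_suminf[of "\<lambda>k. ?x p ^ k" "{..N}"]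
      by (auto simp: sums_iff)
  qed (auto intro: sum_nonneg)
  finally show "(\<Sum>n=1..N. ?x n) \<le> (\<Prod>p\<in>?P. 1 / (1 - ?x p))" .
  have "(\<Prod>p\<in>?P. \<Sum>k\<le>K. ?x p ^ k) \<le> 1 + 1 / d" for K
  proof -
    obtain M where M: "smooth_number ?P ` (?P \<rightarrow>\<^sub>E {..K}) \<subseteq> {..M}"
      using fin[of K] finite_nat_set_iff_bounded_le by (metis atMost_iff subsetI)
    have pos: "smooth_number ?P \<mu> \<ge> 1" for \<mu>
      unfolding smooth_number_def by (intro prod_ge_1) (auto dest!: primes_leD(1) prime_gt_0_nat simp: Suc_le_eq)
    have "smooth_number ?P ` (?P \<rightarrow>\<^sub>E {..K}) \<subseteq> {1..M}"
    proof
      fix n assume n: "n \<in> smooth_number ?P ` (?P \<rightarrow>\<^sub>E {..K})"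
      then have "n \<ge> 1" using pos by (elim imageE) (simp only:)
      moreover have "n \<le> M" using M n by (blast dest: subsetD)
      ultimately show "n \<in> {1..M}" by simp
    qed
    then have "(\<Prod>p\<in>?P. \<Sum>k\<le>K. ?x p ^ k) \<le> (\<Sum>n=1..M. ?x n)"
      unfolding fep by (intro sum_mono2) auto
    also have "\<dots> \<le> 1 + 1 / d" by (rule zeta_partial_sum_bounds[OF assms])
    finally show ?thesis .
  qed
  then show "(\<Prod>p\<in>?P. 1 / (1 - ?x p)) \<le> 1 + 1 / d"
    by (intro LIMSEQ_le_const2[OF tendsto_prod[OF geo]]) auto
qed

section \<open>The prime zeta function near 1\<close>

text \<open>Extension of \<open>f\<close> by 0 off the primes, so that series over primes become ordinary series over the natural
  numbers, to which Tannery's theorem applies.\<close>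

definition over_primes :: "(nat \<Rightarrow> real) \<Rightarrow> nat \<Rightarrow> real" where
  "over_primes f n = (if prime n then f n else 0)"

lemma tendsto_sum_primes_le:
  assumes "summable (over_primes f)"
  shows "(\<lambda>J. \<Sum>p\<in>primes_le (exp (real J)). f p) \<longlonglongrightarrow> suminf (over_primes f)"
proof -
  have "(\<Sum>p\<in>primes_le (exp (real J)). f p) = (\<Sum>n<Suc (nat \<lfloor>exp (real J)\<rfloor>). over_primes f n)" for J
  proof -
    have "primes_le (exp (real J)) = {n \<in> {..<Suc (nat \<lfloor>exp (real J)\<rfloor>)}. prime n}"
      unfolding primes_le_floor[OF exp_ge_zero, of "real J"] primes_le_of_nat
      by (auto simp: less_Suc_eq_le)
    then show ?thesis by (simp only: sum.inter_filter[OF finite_lessThan] over_primes_def)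
  qed
  moreover have "filterlim (\<lambda>J::nat. Suc (nat \<lfloor>exp (real J)\<rfloor>)) at_top at_top"
    by (rule filterlim_compose[OF filterlim_Suc]) real_asymp
  ultimately show ?thesis
    using filterlim_compose[OF summable_LIMSEQ[OF assms]] by (simp del: sum.lessThan_Suc)
qed

lemma summable_prime_zeta: "d > 0 \<Longrightarrow> summable (over_primes (\<lambda>p. real p powr (-1 - d)))"
  by (rule summable_comparison_test'[of "\<lambda>n. real n powr (-1 - d)"])
     (auto simp: summable_real_powr_iff over_primes_def)

text \<open>The part of \<open>- ln (1 - x)\<close> of order two and higher, whose sum over \<open>x = 1 / p\<close> converges.\<close>

definition log_excess :: "real \<Rightarrow> real" where
  "log_excess x = - ln (1 - x) - x"

lemma log_excess_bounds:
  assumes "0 \<le> x" "x \<le> 1 / 2"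
  shows "0 \<le> log_excess x" "log_excess x \<le> 2 * x\<^sup>2"
  using assms ln_one_minus_pos_lower_bound[of x] ln_add_one_self_le_self2[of "-x"]
  by (auto simp: log_excess_def)

lemma log_excess_prime_bounds:
  assumes "d \<ge> 0"
  shows "\<bar>over_primes (\<lambda>p. log_excess (real p powr (-1 - d))) n\<bar> \<le> 2 * real n powr (-2)"
proof (cases "prime n")
  case True
  then have n: "real n \<ge> 2" using prime_ge_2_nat by force
  have "real n powr (-1 - d) \<le> real n powr (-1)" using n assms by (intro powr_mono) auto
  moreover have n1: "real n powr (-1) \<le> 1 / 2" using n by (simp add: powr_minus_divide)
  ultimately have "\<bar>log_excess (real n powr (-1 - d))\<bar> \<le> 2 * (real n powr (-1 - d))\<^sup>2"
    using log_excess_bounds[of "real n powr (-1 - d)"] by simp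
  also have "\<dots> \<le> 2 * (real n powr (-1))\<^sup>2"
    using \<open>real n powr (-1 - d) \<le> real n powr (-1)\<close> by (simp add: power_mono)
  also have "(real n powr (-1))\<^sup>2 = real n powr (-2)"
    using n by (simp add: power2_eq_square powr_minus_divide)
  finally show ?thesis using True by (simp add: over_primes_def)
qed (simp add: over_primes_def)

lemma summable_log_excess: "d \<ge> 0 \<Longrightarrow> summable (over_primes (\<lambda>p. log_excess (real p powr (-1 - d))))"
  by (rule summable_comparison_test'[of "\<lambda>n. 2 * real n powr (-2)"])
     (use log_excess_prime_bounds in \<open>auto simp: summable_real_powr_iff\<close>)

definition total_log_excess :: "real \<Rightarrow> real" where
  "total_log_excess d = suminf (over_primes (\<lambda>p. log_excess (real p powr (-1 - d))))"

text \<open>Tannery's theorem, with the majorant \<open>2 / n\<^sup>2\<close> uniform in \<open>d\<close>.\<close>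

lemma tendsto_total_log_excess: "(total_log_excess \<longlongrightarrow> total_log_excess 0) (at_right 0)"
proof -
  have lim: "((\<lambda>d. over_primes (\<lambda>p. log_excess (real p powr (-1 - d))) n) \<longlongrightarrow>
      over_primes (\<lambda>p. log_excess (real p powr (-1 - 0))) n) (at_right 0)" for n
  proof (cases "prime n")
    case True
    then have "real n > 1" using prime_gt_1_nat by force
    then have "1 - real n powr (-1 - 0) \<noteq> 0" by (simp add: powr_minus_divide)
    moreover have "real n \<noteq> 0" using \<open>real n > 1\<close> by simp
    ultimately show ?thesis
      unfolding over_primes_def log_excess_def if_P[OF True]
      by (intro tendsto_intros) simp_all
  qed (simp add: over_primes_def)
  have pos: "\<forall>\<^sub>F d::real in at_right 0. d > 0" by (rule eventually_at_right_less)
  have "\<forall>\<^sub>F (n, d) in at_top \<times>\<^sub>F at_right 0.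
      norm (over_primes (\<lambda>p. log_excess (real p powr (-1 - d))) n) \<le> 2 * real n powr (-2)"
    unfolding eventually_prod_filter case_prod_conv
    by (rule exI[of _ "\<lambda>_. True"], rule exI[of _ "\<lambda>d. d > 0"]) (use pos log_excess_prime_bounds in auto)
  from tannerys_theorem[OF lim this] show ?thesis
    unfolding total_log_excess_def[abs_def] by (simp add: summable_real_powr_iff)
qed

text \<open>The quantity bounded here is \<open>ln (zeta (1 + d))\<close>, by the Euler product. Only its asymptotic equality with
  \<open>ln (1 / d)\<close> for \<open>d\<close> tending to 0 matters later.\<close>

lemma prime_zeta_bounds:
  fixes d :: real
  assumes "d > 0"
  defines "Z \<equiv> suminf (over_primes (\<lambda>p. real p powr (-1 - d))) + total_log_excess d"
  shows "- ln d \<le> Z" "Z \<le> ln (1 + 1 / d)"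
proof -
  let ?x = "\<lambda>p. real p powr (-1 - d)"
  have lim: "(\<lambda>J. \<Sum>p\<in>primes_le (exp (real J)). - ln (1 - ?x p)) \<longlonglongrightarrow> Z"
  proof -
    have "(\<lambda>J. (\<Sum>p\<in>primes_le (exp (real J)). ?x p) + (\<Sum>p\<in>primes_le (exp (real J)). log_excess (?x p))) \<longlonglongrightarrow> Z"
      unfolding Z_def total_log_excess_def using assms(1)
      by (intro tendsto_add tendsto_sum_primes_le summable_prime_zeta summable_log_excess) auto
    then show ?thesis by (simp add: log_excess_def flip: sum.distrib)
  qed
  define N where "N J = nat \<lfloor>exp (real J)\<rfloor>" for J :: nat
  have P: "primes_le (exp (real J)) = primes_le (real (N J))" for J
    unfolding N_def by (rule primes_le_floor) simp
  have x: "0 < ?x p" "?x p < 1" if "p \<in> primes_le y" for p y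
    using primes_leD[OF that] assms powr_less_mono2_neg[of "-1 - d" 1 "real p"] by auto
  have lnprod: "(\<Sum>p\<in>primes_le y. - ln (1 - ?x p)) = ln (\<Prod>p\<in>primes_le y. 1 / (1 - ?x p))" for y
    by (subst ln_prod) (auto simp: ln_div intro!: sum.cong dest: x)
  have prodpos: "(\<Prod>p\<in>primes_le y. 1 / (1 - ?x p)) > 0" for y
    by (intro prod_pos) (auto dest: x)
  show "Z \<le> ln (1 + 1 / d)"
  proof (rule LIMSEQ_le_const2[OF lim], intro exI allI impI)
    fix J
    show "(\<Sum>p\<in>primes_le (exp (real J)). - ln (1 - ?x p)) \<le> ln (1 + 1 / d)"
      unfolding lnprod using euler_product_bounds(2)[OF assms(1), of "N J"] prodpos assms(1)
      by (subst ln_le_cancel_iff) (auto simp: P add_pos_pos)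
  qed
  have "filterlim (\<lambda>J. real (N J) + 1) at_top at_top"
    unfolding N_def by real_asymp
  then have "(\<lambda>J. (1 - (real (N J) + 1) powr (-d)) / d) \<longlonglongrightarrow> (1 - 0) / d"
    using assms(1)
    by (intro tendsto_intros tendsto_neg_powr) auto
  then have "(\<lambda>J. ln ((1 - (real (N J) + 1) powr (-d)) / d)) \<longlonglongrightarrow> ln ((1 - 0) / d)"
    using assms(1) by (intro tendsto_ln) auto
  moreover have "\<forall>\<^sub>F J in sequentially. ln ((1 - (real (N J) + 1) powr (-d)) / d)
      \<le> (\<Sum>p\<in>primes_le (exp (real J)). - ln (1 - ?x p))"
  proof (intro always_eventually allI)
    fix J
    have "N J \<ge> 1" unfolding N_def by (simp add: le_nat_iff)
    then have "(real (N J) + 1) powr (-d) < 1"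
      using assms(1) powr_less_mono2_neg[of "-d" 1 "real (N J) + 1"] by auto
    moreover have "(1 - (real (N J) + 1) powr (-d)) / d \<le> (\<Prod>p\<in>primes_le (exp (real J)). 1 / (1 - ?x p))"
      using euler_product_bounds(1)[OF assms(1), of "N J"] zeta_partial_sum_bounds(1)[OF assms(1), of "N J"]
      unfolding P by linarith
    ultimately show "ln ((1 - (real (N J) + 1) powr (-d)) / d) \<le> (\<Sum>p\<in>primes_le (exp (real J)). - ln (1 - ?x p))"
      unfolding lnprod using prodpos assms(1) by (subst ln_le_cancel_iff) auto
  qed
  ultimately have "ln ((1 - 0) / d) \<le> Z"
    by (intro tendsto_le[OF _ lim]) auto
  then show "- ln d \<le> Z" using assms(1) by (simp add: ln_div)
qed

section \<open>Mertens' third theorem\<close>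

lemma harmonic_power_series:
  fixes z :: real
  assumes "0 < z" "z < 1"
  shows "(\<lambda>i. 1 / (real i + 1) * z ^ i) sums (- ln (1 - z) / z)"
proof -
  have "(\<lambda>n. - ((z ^ n) / real n)) sums ln (1 - z)"
    using ln_series'[of "-z"] assms by simp
  then have "(\<lambda>n. - ((z ^ Suc n) / real (Suc n))) sums ln (1 - z)"
    by (subst sums_Suc_iff) simp
  then have "(\<lambda>n. - ((z ^ Suc n) / real (Suc n)) * (- 1 / z)) sums (ln (1 - z) * (- 1 / z))"
    by (rule sums_mult2)
  then show ?thesis using assms by (simp add: add_ac)
qed

text \<open>On the block \<open>i\<close> the factor \<open>p powr (-d)\<close> lies between \<open>z ^ (i + 1)\<close> and \<open>z ^ i\<close>, so the prime zeta function
  is squeezed between \<open>z\<close> times and 1 times the power series with coefficients \<^term>\<open>block_recip i\<close>. Splitting off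
  the series of \<open>1 / (i + 1)\<close> produces the logarithms.\<close>

lemma prime_zeta_block_bounds:
  fixes d :: real
  assumes d: "d > 0"
  defines "z \<equiv> exp (-d)"
  defines "f \<equiv> (\<Sum>i. (block_recip i - 1 / (real i + 1)) * z ^ i)"
  defines "S \<equiv> suminf (over_primes (\<lambda>p. real p powr (-1 - d)))"
  shows "z * f - ln (1 - z) \<le> S" "S \<le> f - ln (1 - z) / z"
proof -
  have z: "0 < z" "z < 1" using d by (auto simp: z_def)
  have "(\<lambda>i. (block_recip i - 1 / (real i + 1)) * z ^ i) sums f"
    unfolding f_def using abel_limit(2)[OF summable_sums[OF summable_block_recip_minus_harmonic]] z
    by (intro summable_sums) auto
  from sums_add[OF this harmonic_power_series[OF z]]
  have blocks: "(\<lambda>i. block_recip i * z ^ i) sums (f - ln (1 - z) / z)"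
    by (simp add: algebra_simps)
  have zpow: "z ^ i = exp (- d * real i)" for i
    by (simp add: z_def exp_of_nat_mult[symmetric] mult_ac)
  have split: "real p powr (-1 - d) = 1 / real p * exp (- d * ln (real p))" if "p \<in> prime_block i" for p i
    using prime_blockD[OF that] by (simp add: powr_diff powr_minus_divide) (simp add: powr_def exp_minus field_simps)
  have up: "(\<Sum>p\<in>prime_block i. real p powr (-1 - d)) \<le> block_recip i * z ^ i" for i
    unfolding block_recip_def sum_distrib_right
  proof (intro sum_mono)
    fix p assume p: "p \<in> prime_block i"
    show "real p powr (-1 - d) \<le> 1 / real p * z ^ i"
      unfolding split[OF p] zpow using prime_blockD[OF p] d by (intro mult_left_mono) auto
  qed
  have low: "block_recip i * z ^ i * z \<le> (\<Sum>p\<in>prime_block i. real p powr (-1 - d))" for i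
    unfolding block_recip_def sum_distrib_right
  proof (intro sum_mono)
    fix p assume p: "p \<in> prime_block i"
    have "z ^ i * z = exp (- d * (real i + 1))"
      unfolding zpow by (simp add: z_def algebra_simps flip: exp_add)
    also have "\<dots> \<le> exp (- d * ln (real p))" using prime_blockD[OF p] d by simp
    finally show "1 / real p * z ^ i * z \<le> real p powr (-1 - d)"
      unfolding split[OF p] using prime_blockD[OF p] by (simp add: mult_left_mono divide_right_mono)
  qed
  have lim: "(\<lambda>J. \<Sum>i<J. \<Sum>p\<in>prime_block i. real p powr (-1 - d)) \<longlonglongrightarrow> S"
    using tendsto_sum_primes_le[OF summable_prime_zeta[OF d]] unfolding S_def sum_prime_blocks .
  show "S \<le> f - ln (1 - z) / z"
    by (rule LIMSEQ_le[OF lim blocks[unfolded sums_def]]) (auto intro!: exI sum_mono up)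
  have "(\<lambda>i. block_recip i * z ^ i * z) sums ((f - ln (1 - z) / z) * z)"
    by (rule sums_mult2[OF blocks])
  then have "(f - ln (1 - z) / z) * z \<le> S"
    unfolding sums_def by (rule LIMSEQ_le[OF _ lim]) (auto intro!: exI sum_mono low)
  then show "z * f - ln (1 - z) \<le> S" using z by (simp add: algebra_simps)
qed

text \<open>As \<open>d\<close> tends to 0, the power series \<open>f d\<close> tends to the sum on the left by Abel's theorem. The bounds on the
  prime zeta function by blocks and by the Euler product differ by \<open>o(1)\<close>, since
  \<open>ln (1 - exp (-d)) = ln d + o(1)\<close>; comparing them identifies the limit.\<close>

lemma block_constant:
  "(\<Sum>i. block_recip i - 1 / (real i + 1)) = - total_log_excess 0"
proof -
  define L where "L = (\<Sum>i. block_recip i - 1 / (real i + 1))"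
  define f where "f d = (\<Sum>i. (block_recip i - 1 / (real i + 1)) * exp (-d) ^ i)" for d :: real
  \<comment> \<open>The substitution \<open>z = exp (-d)\<close> carries the left limit at 1 to the right limit at 0.\<close>
  have "filterlim (\<lambda>d::real. exp (-d)) (at_left 1) (at_right 0)" by real_asymp
  from filterlim_compose[OF abel_limit(1)[OF summable_sums[OF summable_block_recip_minus_harmonic]] this]
  have f: "(f \<longlongrightarrow> L) (at_right 0)" by (simp add: f_def[abs_def] L_def)
  have pos: "\<forall>\<^sub>F d::real in at_right 0. d > 0" by (rule eventually_at_right_less)
  have "L + total_log_excess 0 \<ge> 0"
  proof (rule tendsto_le)
    show "((\<lambda>d. f d + total_log_excess d) \<longlongrightarrow> L + total_log_excess 0) (at_right 0)"
      by (intro tendsto_add f tendsto_total_log_excess)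
    show "((\<lambda>d::real. ln (1 - exp (-d)) / exp (-d) - ln d) \<longlongrightarrow> 0) (at_right 0)" by real_asymp
    show "\<forall>\<^sub>F d in at_right 0. ln (1 - exp (-d)) / exp (-d) - ln d \<le> f d + total_log_excess d"
      using pos
    proof eventually_elim
      case (elim d)
      show ?case using prime_zeta_block_bounds(2)[OF elim] prime_zeta_bounds(1)[OF elim]
        unfolding f_def by linarith
    qed
  qed simp
  moreover have "1 * L + total_log_excess 0 \<le> 0"
  proof (rule tendsto_le)
    have "((\<lambda>d::real. exp (-d)) \<longlongrightarrow> 1) (at_right 0)" by real_asymp
    then show "((\<lambda>d. exp (-d) * f d + total_log_excess d) \<longlongrightarrow> 1 * L + total_log_excess 0) (at_right 0)"
      by (intro tendsto_add tendsto_mult f tendsto_total_log_excess)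
    show "((\<lambda>d::real. ln (1 + 1 / d) + ln (1 - exp (-d))) \<longlongrightarrow> 0) (at_right 0)" by real_asymp
    show "\<forall>\<^sub>F d in at_right 0. exp (-d) * f d + total_log_excess d \<le> ln (1 + 1 / d) + ln (1 - exp (-d))"
      using pos
    proof eventually_elim
      case (elim d)
      show ?case using prime_zeta_block_bounds(1)[OF elim] prime_zeta_bounds(2)[OF elim]
        unfolding f_def by linarith
    qed
  qed simp
  ultimately show ?thesis unfolding L_def by linarith
qed

definition mertens_product :: "real \<Rightarrow> real" where
  "mertens_product x = (\<Prod>p\<in>primes_le x. 1 / (1 - 1 / real p))"

lemma mertens_product_mono: "x \<le> y \<Longrightarrow> mertens_product x \<le> mertens_product y"
  unfolding mertens_product_def
proof (intro prod_mono2 primes_le_mono)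
  fix p assume "p \<in> primes_le y - primes_le x"
  then have "real p \<ge> 2" using primes_leD(2) by blast
  then show "1 \<le> 1 / (1 - 1 / real p)" by (simp add: divide_simps)
next
  fix p assume "p \<in> primes_le x"
  then have "real p \<ge> 2" using primes_leD(2) by blast
  then show "0 \<le> 1 / (1 - 1 / real p)" by (simp add: divide_simps)
qed auto

lemma mertens_product_pos: "mertens_product x > 0"
  unfolding mertens_product_def
proof (intro prod_pos ballI)
  fix p assume "p \<in> primes_le x"
  then have "real p \<ge> 2" using primes_leD(2) by blast
  then show "0 < 1 / (1 - 1 / real p)" by (simp add: divide_simps)
qed

text \<open>The sum of \<open>block_recip i\<close> is a harmonic number plus a convergent series. The limit of that series
  cancels the total logarithmic excess, so that the only constant left is the one in \<open>harm J - ln J\<close>.\<close>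

lemma mertens_product_exp_limit:
  "(\<lambda>J. mertens_product (exp (real J)) / real J) \<longlonglongrightarrow> exp euler_mascheroni"
proof -
  have factor: "ln (1 / (1 - 1 / real p)) = 1 / real p + log_excess (real p powr (-1 - 0))"
    "1 / (1 - 1 / real p) > 0" if "p \<in> primes_le y" for p y
  proof -
    have p: "1 / real p < 1" using primes_leD(2)[OF that] by simp
    then show "1 / (1 - 1 / real p) > 0" by simp
    have "real p powr (-1 - 0) = 1 / real p" by (simp add: powr_minus_divide)
    then show "ln (1 / (1 - 1 / real p)) = 1 / real p + log_excess (real p powr (-1 - 0))"
      using p by (simp only: log_excess_def) (simp add: ln_div)
  qed
  have "ln (mertens_product (exp (real J))) =
      (\<Sum>i<J. block_recip i - 1 / (real i + 1)) + (\<Sum>p\<in>primes_le (exp (real J)). log_excess (real p powr (-1 - 0))) + harm J" for J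
  proof -
    have "ln (mertens_product (exp (real J))) = (\<Sum>p\<in>primes_le (exp (real J)). 1 / real p + log_excess (real p powr (-1 - 0)))"
    proof -
      have "ln (mertens_product (exp (real J))) = (\<Sum>p\<in>primes_le (exp (real J)). ln (1 / (1 - 1 / real p)))"
        unfolding mertens_product_def
        using less_imp_neq[OF factor(2), symmetric] by (intro ln_prod finite_primes_le)
      then show ?thesis by (simp only: factor(1) cong: sum.cong)
    qed
    also have "\<dots> = (\<Sum>i<J. block_recip i) + (\<Sum>p\<in>primes_le (exp (real J)). log_excess (real p powr (-1 - 0)))"
      by (simp only: sum.distrib sum_prime_blocks block_recip_def)
    also have "(\<Sum>i<J. block_recip i) = (\<Sum>i<J. block_recip i - 1 / (real i + 1)) + harm J"
      by (simp add: sum_subtractf harm_def sum.atLeast1_atMost_eq inverse_eq_divide add_ac)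
    finally show ?thesis by simp
  qed
  moreover have "(\<lambda>J. ((\<Sum>i<J. block_recip i - 1 / (real i + 1)) + (\<Sum>p\<in>primes_le (exp (real J)). log_excess (real p powr (-1 - 0)))) + (harm J - ln (real J)))
      \<longlonglongrightarrow> (- total_log_excess 0 + total_log_excess 0) + euler_mascheroni"
    by (intro tendsto_add euler_mascheroni_LIMSEQ)
      (use summable_LIMSEQ[OF summable_block_recip_minus_harmonic] tendsto_sum_primes_le[OF summable_log_excess[of 0]]
        in \<open>simp_all add: block_constant total_log_excess_def\<close>)
  ultimately have "(\<lambda>J. ln (mertens_product (exp (real J))) - ln (real J)) \<longlonglongrightarrow> euler_mascheroni"
    by (simp add: algebra_simps)
  from tendsto_exp[OF this] show ?thesis
  proof (rule Lim_transform_eventually)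
    show "\<forall>\<^sub>F J in sequentially. exp (ln (mertens_product (exp (real J))) - ln (real J)) = mertens_product (exp (real J)) / real J"
      using eventually_gt_at_top[of 0] by eventually_elim (simp add: exp_diff mertens_product_pos)
  qed
qed

text \<open>Interpolation between consecutive powers of \<open>exp 1\<close>: the product is monotone and \<open>ln x\<close> changes by at most 1
  between them.\<close>

theorem mertens_third: "((\<lambda>x. mertens_product x / ln x) \<longlongrightarrow> exp euler_mascheroni) at_top"
proof -
  define J where "J x = nat \<lfloor>ln x\<rfloor>" for x :: real
  define g where "g J = mertens_product (exp (real J)) / real J" for J :: nat
  have J: "filterlim J at_top at_top" unfolding J_def by real_asymp
  have g: "g \<longlonglongrightarrow> exp euler_mascheroni" unfolding g_def by (rule mertens_product_exp_limit)
  have "((\<lambda>J. g J * (real J / (real J + 1))) \<longlongrightarrow> exp euler_mascheroni * 1) sequentially"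
    by (intro tendsto_mult g) real_asymp
  from filterlim_compose[OF this J] have low: "((\<lambda>x. g (J x) * (real (J x) / (real (J x) + 1))) \<longlongrightarrow> exp euler_mascheroni) at_top"
    by simp
  have "((\<lambda>J. g (Suc J) * ((real J + 1) / real J)) \<longlongrightarrow> exp euler_mascheroni * 1) sequentially"
    by (intro tendsto_mult LIMSEQ_Suc[OF g]) real_asymp
  from filterlim_compose[OF this J] have up: "((\<lambda>x. g (Suc (J x)) * ((real (J x) + 1) / real (J x))) \<longlongrightarrow> exp euler_mascheroni) at_top"
    by simp
  have ev: "\<forall>\<^sub>F x::real in at_top. x \<ge> exp 1" by (rule eventually_ge_at_top)
  have bounds: "J x > 0" "real (J x) \<le> ln x" "ln x \<le> real (J x) + 1" "exp (real (J x)) \<le> x" "x \<le> exp (real (Suc (J x)))"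
    if "x \<ge> exp 1" for x
  proof -
    have x: "x > 0" using that less_le_trans[OF exp_gt_zero] by blast
    then have l: "ln x \<ge> 1" using that by (simp add: ln_ge_iff)
    then have "1 \<le> \<lfloor>ln x\<rfloor>" by simp
    then show "J x > 0" by (simp add: J_def)
    have "real (J x) = real_of_int \<lfloor>ln x\<rfloor>" using l by (simp add: J_def)
    then show *: "real (J x) \<le> ln x" "ln x \<le> real (J x) + 1" by linarith+
    show "exp (real (J x)) \<le> x" using * x by (simp add: ln_ge_iff)
    show "x \<le> exp (real (Suc (J x)))" using *(2) x exp_le_cancel_iff[of "ln x" "real (J x) + 1"] by (simp add: add_ac)
  qed
  show ?thesis
  proof (rule tendsto_sandwich[OF _ _ low up])
    show "\<forall>\<^sub>F x in at_top. g (J x) * (real (J x) / (real (J x) + 1)) \<le> mertens_product x / ln x"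
      using ev
    proof eventually_elim
      case (elim x)
      have "g (J x) * (real (J x) / (real (J x) + 1)) = mertens_product (exp (real (J x))) / (real (J x) + 1)"
        using bounds[OF elim] by (simp add: g_def)
      also have "\<dots> \<le> mertens_product x / ln x"
        using bounds[OF elim] mertens_product_mono[OF bounds(4)[OF elim]] mertens_product_pos
        by (intro frac_le) (auto intro: less_imp_le)
      finally show ?case .
    qed
    show "\<forall>\<^sub>F x in at_top. mertens_product x / ln x \<le> g (Suc (J x)) * ((real (J x) + 1) / real (J x))"
      using ev
    proof eventually_elim
      case (elim x)
      have "mertens_product x / ln x \<le> mertens_product (exp (real (Suc (J x)))) / real (J x)"
        using bounds[OF elim] mertens_product_mono[OF bounds(5)[OF elim]] mertens_product_pos
        by (intro frac_le) (auto intro: less_imp_le)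
      also have "\<dots> = g (Suc (J x)) * ((real (J x) + 1) / real (J x))"
        by (simp add: g_def add_ac)
      finally show ?case .
    qed
  qed
qed

section \<open>Iterated logarithms and the product formula for Phi1\<close>

lemma loglog_ge_1: "loglog x \<ge> 1"
proof (cases "x \<le> exp (exp 1)")
  case False
  then have *: "exp (exp 1) < x" by simp
  have "exp 1 < ln x"
    using * less_trans[OF exp_gt_zero *] by (metis exp_less_cancel_iff exp_ln)
  then have "1 < ln (ln x)"
    using less_trans[OF exp_gt_zero] by (metis exp_less_cancel_iff exp_ln)
  then show ?thesis using False by (simp add: loglog_def)
qed (simp add: loglog_def)

lemma loglog_eq: "x \<ge> exp (exp 1) \<Longrightarrow> loglog x = ln (ln x)"
  by (cases "x = exp (exp 1)") (auto simp: loglog_def)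

lemma loglog_mono:
  assumes "x \<le> y"
  shows "loglog x \<le> loglog y"
proof (cases "x \<le> exp (exp 1)")
  case True
  then show ?thesis using loglog_ge_1[of y] by (simp add: loglog_def)
next
  case False
  then have *: "exp (exp 1) < x" by simp
  have x: "x > 0" using less_trans[OF exp_gt_zero *] .
  then have "exp 1 < ln x" using * by (metis exp_less_cancel_iff exp_ln)
  then have "ln x > 0" using less_trans[OF exp_gt_zero] by blast
  then show ?thesis using x False assms by (auto simp: loglog_def)
qed

lemma logloglog_eq_loglog_ln:
  assumes "x > 0"
  shows "logloglog x = loglog (ln x)"
proof -
  have "x \<le> exp (exp (exp 1)) \<longleftrightarrow> ln x \<le> exp (exp 1)"
    using assms by (metis exp_le_cancel_iff exp_ln)
  then show ?thesis by (simp add: logloglog_def loglog_def)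
qed

text \<open>Concavity: \<open>ln (ln t) - ln (ln y)\<close> is at most \<open>t / y - 1\<close> by applying \<open>ln s \<le> s - 1\<close> twice, and
  \<^term>\<open>loglog y\<close> is at least 1.\<close>

lemma loglog_linear_growth:
  assumes "exp (exp 1) \<le> y" "y \<le> t"
  shows "loglog t / t \<le> loglog y / y"
proof -
  have y: "y > 0" using less_le_trans[OF exp_gt_zero assms(1)] .
  then have ly: "ln y \<ge> exp 1" using assms(1) by (simp add: ln_ge_iff)
  then have ly1: "ln y \<ge> 1" using exp_ge_add_one_self[of 1] by linarith
  have lt: "ln t \<ge> ln y" using assms y by simp
  have "ln (ln t) - ln (ln y) = ln (ln t / ln y)" using ly1 lt by (subst ln_div) auto
  also have "\<dots> \<le> ln t / ln y - 1" using ly1 lt by (intro ln_le_minus_one) auto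
  also have "\<dots> = ln (t / y) / ln y" using ly1 y assms by (simp add: ln_div diff_divide_distrib) (use ly1 in auto)
  also have "\<dots> \<le> ln (t / y) / 1"
  proof (rule divide_left_mono)
    show "1 \<le> ln y" by (rule ly1)
    show "0 \<le> ln (t / y)" using y assms by (intro ln_ge_zero) simp
  qed (use ly1 in simp)
  also have "\<dots> = ln (t / y)" by simp
  also have "\<dots> \<le> t / y - 1" using y assms by (intro ln_le_minus_one) auto
  also have "\<dots> \<le> (t / y - 1) * loglog y"
    using loglog_ge_1[of y] y assms mult_left_mono[of 1 "loglog y" "t / y - 1"] by simp
  finally have "loglog t \<le> t / y * loglog y"
    using assms by (simp add: loglog_eq algebra_simps)
  then show ?thesis using y assms by (simp add: field_simps)
qed

text \<open>For \<open>a = multiplicity p n\<close> these are the local factors of \<open>\<sigma>(n) / n\<close>, and below, the local factors in which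
  each divisor \<open>p ^ m\<close> is weighted by its exponent.\<close>

definition geom_sum :: "nat \<Rightarrow> nat \<Rightarrow> real" where
  "geom_sum p a = (\<Sum>m\<le>a. 1 / real p ^ m)"

definition weighted_geom_sum :: "nat \<Rightarrow> nat \<Rightarrow> real" where
  "weighted_geom_sum p a = (\<Sum>m\<le>a. real m / real p ^ m)"

lemma geom_sum_eq: "p \<ge> 2 \<Longrightarrow> geom_sum p a = (1 - 1 / real p ^ Suc a) / (1 - 1 / real p)"
  unfolding geom_sum_def
  by (induction a) (auto simp: divide_simps, auto simp: algebra_simps)

lemma geom_sum_bounds:
  assumes "p \<ge> 2"
  shows "geom_sum p a \<ge> 1" "geom_sum p a \<le> 1 / (1 - 1 / real p)"
proof -
  show "geom_sum p a \<ge> 1"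
    unfolding geom_sum_def using sum_mono2[of "{..a}" "{0}" "\<lambda>m. 1 / real p ^ m"] by simp
  have "1 - 1 / real p > 0" using assms by simp
  then show "geom_sum p a \<le> 1 / (1 - 1 / real p)"
    unfolding geom_sum_eq[OF assms] by (intro divide_right_mono) auto
qed

text \<open>Multiplying by \<open>p - 1\<close> telescopes the sum into \<^term>\<open>geom_sum p a\<close> minus a boundary term.\<close>

lemma weighted_geom_sum_le:
  assumes "p \<ge> 2"
  shows "weighted_geom_sum p a \<le> geom_sum p a / (real p - 1)"
proof -
  have "(real p - 1) * weighted_geom_sum p a = geom_sum p a - (real a + 1) / real p ^ a"
    unfolding weighted_geom_sum_def geom_sum_def using assms
    by (induction a) (auto simp: divide_simps, auto simp: algebra_simps)
  also have "\<dots> \<le> geom_sum p a" by simp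
  finally show ?thesis using assms by (simp add: pos_le_divide_eq mult.commute)
qed

text \<open>The quotient of the two sums is the mean exponent under the weights \<open>1 / p ^ m\<close>; for \<open>a = 1\<close> it equals
  \<open>1 / (p + 1)\<close>.\<close>

lemma weighted_geom_sum_ge:
  assumes "p \<ge> 2" "a \<ge> 1"
  shows "geom_sum p a / (real p + 1) \<le> weighted_geom_sum p a"
proof -
  have "1 + 1 / real p \<le> geom_sum p a"
    unfolding geom_sum_def using sum_mono2[of "{..a}" "{0, 1}" "\<lambda>m. 1 / real p ^ m"] assms by simp
  then have "real p + 1 \<le> real p * geom_sum p a"
    using assms by (simp add: field_simps)
  moreover have "geom_sum p a - 1 \<le> weighted_geom_sum p a"
  proof -
    have "geom_sum p a - 1 = (\<Sum>m\<in>{..a} - {0}. 1 / real p ^ m)"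
      unfolding geom_sum_def by (subst sum_diff) auto
    also have "\<dots> \<le> (\<Sum>m\<in>{..a} - {0}. real m / real p ^ m)"
      by (intro sum_mono divide_right_mono) auto
    also have "\<dots> = weighted_geom_sum p a"
      unfolding weighted_geom_sum_def by (intro sum.mono_neutral_left) auto
    finally show ?thesis .
  qed
  moreover have "(geom_sum p a - 1) * (real p + 1) \<ge> geom_sum p a"
    using calculation(1) by (simp add: algebra_simps)
  ultimately have "geom_sum p a \<le> weighted_geom_sum p a * (real p + 1)"
    by (meson mult_right_mono of_nat_0_le_iff add_nonneg_nonneg zero_le_one order_trans)
  then show ?thesis by (simp add: pos_divide_le_eq add_pos_nonneg)
qed

text \<open>Expanding the numerator of \<^const>\<open>Phi1\<close> and swapping the sums leaves, for each \<open>p\<close>, a sum over exponent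
  vectors of a product over primes. Such a sum factors, and only the factor at \<open>p\<close> carries the weight.\<close>

lemma Phi1_eq:
  "Phi1 n = (\<Sum>p\<in>prime_factors n. ln (real p) * loglog (real p) * weighted_geom_sum p (multiplicity p n) *
      (\<Prod>q\<in>prime_factors n - {p}. geom_sum q (multiplicity q n)))"
proof -
  define P where "P = prime_factors n"
  define a where "a p = multiplicity p n" for p
  have fin: "finite P" by (simp add: P_def)
  have "Phi1 n = (\<Sum>\<mu>\<in>(\<Pi>\<^sub>E p\<in>P. {0..a p}). \<Sum>p\<in>P. ln (real p) * loglog (real p) *
      (\<Prod>q\<in>P. (if q = p then real (\<mu> q) else 1) / real q ^ \<mu> q))"
    unfolding Phi1_def P_def[symmetric] a_def[symmetric]
  proof (intro sum.cong refl)
    fix \<mu> :: "nat \<Rightarrow> nat"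
    have "(\<Prod>q\<in>P. (if q = p then real (\<mu> q) else 1) / real q ^ \<mu> q) = real (\<mu> p) / (\<Prod>q\<in>P. real q ^ \<mu> q)"
      if "p \<in> P" for p
      using that fin by (simp add: prod_dividef prod.delta)
    then show "(\<Sum>p\<in>P. real (\<mu> p) * ln (real p) * loglog (real p)) / (\<Prod>p\<in>P. real p ^ \<mu> p) =
        (\<Sum>p\<in>P. ln (real p) * loglog (real p) * (\<Prod>q\<in>P. (if q = p then real (\<mu> q) else 1) / real q ^ \<mu> q))"
      by (simp add: sum_divide_distrib mult_ac cong: sum.cong)
  qed
  also have "\<dots> = (\<Sum>p\<in>P. ln (real p) * loglog (real p) *
      (\<Sum>\<mu>\<in>(\<Pi>\<^sub>E p\<in>P. {0..a p}). \<Prod>q\<in>P. (if q = p then real (\<mu> q) else 1) / real q ^ \<mu> q))"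
    by (subst sum.swap) (simp add: sum_distrib_left)
  also have "\<dots> = (\<Sum>p\<in>P. ln (real p) * loglog (real p) *
      (\<Prod>q\<in>P. \<Sum>m\<in>{0..a q}. (if q = p then real m else 1) / real q ^ m))"
    by (subst prod_sum_PiE[OF fin]) auto
  also have "\<dots> = (\<Sum>p\<in>P. ln (real p) * loglog (real p) * weighted_geom_sum p (a p) * (\<Prod>q\<in>P - {p}. geom_sum q (a q)))"
  proof (intro sum.cong refl)
    fix p assume p: "p \<in> P"
    have "(\<Prod>q\<in>P - {p}. \<Sum>m\<in>{0..a q}. (if q = p then real m else 1) / real q ^ m) = (\<Prod>q\<in>P - {p}. geom_sum q (a q))"
      by (intro prod.cong) (auto simp: geom_sum_def atLeast0AtMost)
    then show "ln (real p) * loglog (real p) * (\<Prod>q\<in>P. \<Sum>m\<in>{0..a q}. (if q = p then real m else 1) / real q ^ m) =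
        ln (real p) * loglog (real p) * weighted_geom_sum p (a p) * (\<Prod>q\<in>P - {p}. geom_sum q (a q))"
      by (subst prod.remove[OF fin p]) (simp add: weighted_geom_sum_def atLeast0AtMost)
  qed
  finally show ?thesis by (simp add: P_def a_def)
qed

text \<open>The mean exponent of \<open>p\<close> lies between \<open>1 / (p + 1)\<close> and \<open>1 / (p - 1)\<close>, so that \<^const>\<open>Phi1\<close> is, up to these
  bounds, \<open>\<sigma>(n) / n\<close> times a sum over the prime factors.\<close>

lemma Phi1_bounds:
  shows "Phi1 n \<le> (\<Prod>q\<in>prime_factors n. geom_sum q (multiplicity q n)) *
      (\<Sum>p\<in>prime_factors n. ln (real p) * loglog (real p) / (real p - 1))"
    and "(\<Prod>q\<in>prime_factors n. geom_sum q (multiplicity q n)) *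
      (\<Sum>p\<in>prime_factors n. ln (real p) * loglog (real p) / (real p + 1)) \<le> Phi1 n"
proof -
  define P where "P = prime_factors n"
  define a where "a p = multiplicity p n" for p
  have P: "p \<ge> 2" "a p \<ge> 1" if "p \<in> P" for p
    using that by (auto simp: P_def a_def prime_factors_multiplicity prime_ge_2_nat)
  have w: "ln (real p) * loglog (real p) \<ge> 0" if "p \<in> P" for p
    using P(1)[OF that] loglog_ge_1[of "real p"] by simp
  have rest: "(\<Prod>q\<in>P - {p}. geom_sum q (a q)) \<ge> 0" for p
    using geom_sum_bounds(1) P(1) by (intro prod_nonneg) (meson DiffD1 order_trans zero_le_one)
  have split: "(\<Prod>q\<in>P. geom_sum q (a q)) = geom_sum p (a p) * (\<Prod>q\<in>P - {p}. geom_sum q (a q))" if "p \<in> P" for p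
    using that by (intro prod.remove) (auto simp: P_def)
  show "Phi1 n \<le> (\<Prod>q\<in>prime_factors n. geom_sum q (multiplicity q n)) *
      (\<Sum>p\<in>prime_factors n. ln (real p) * loglog (real p) / (real p - 1))"
    unfolding Phi1_eq P_def[symmetric] a_def[symmetric] sum_distrib_left
  proof (intro sum_mono)
    fix p assume p: "p \<in> P"
    have "ln (real p) * loglog (real p) * weighted_geom_sum p (a p) * (\<Prod>q\<in>P - {p}. geom_sum q (a q))
        \<le> ln (real p) * loglog (real p) * (geom_sum p (a p) / (real p - 1)) * (\<Prod>q\<in>P - {p}. geom_sum q (a q))"
      using P[OF p] w[OF p] rest by (intro mult_right_mono mult_left_mono weighted_geom_sum_le) auto
    then show "ln (real p) * loglog (real p) * weighted_geom_sum p (a p) * (\<Prod>q\<in>P - {p}. geom_sum q (a q))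
        \<le> (\<Prod>q\<in>P. geom_sum q (a q)) * (ln (real p) * loglog (real p) / (real p - 1))"
      unfolding split[OF p] by (simp add: mult_ac)
  qed
  show "(\<Prod>q\<in>prime_factors n. geom_sum q (multiplicity q n)) *
      (\<Sum>p\<in>prime_factors n. ln (real p) * loglog (real p) / (real p + 1)) \<le> Phi1 n"
    unfolding Phi1_eq P_def[symmetric] a_def[symmetric] sum_distrib_left
  proof (intro sum_mono)
    fix p assume p: "p \<in> P"
    have "ln (real p) * loglog (real p) * (geom_sum p (a p) / (real p + 1)) * (\<Prod>q\<in>P - {p}. geom_sum q (a q))
        \<le> ln (real p) * loglog (real p) * weighted_geom_sum p (a p) * (\<Prod>q\<in>P - {p}. geom_sum q (a q))"
      using P[OF p] w[OF p] rest by (intro mult_right_mono mult_left_mono weighted_geom_sum_ge) auto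
    then show "(\<Prod>q\<in>P. geom_sum q (a q)) * (ln (real p) * loglog (real p) / (real p + 1))
        \<le> ln (real p) * loglog (real p) * weighted_geom_sum p (a p) * (\<Prod>q\<in>P - {p}. geom_sum q (a q))"
      unfolding split[OF p] by (simp add: mult_ac)
  qed
qed

section \<open>Bounds for the two factors\<close>

lemma sum_ln_prime_factors_le:
  assumes "n > 0"
  shows "(\<Sum>p\<in>prime_factors n. ln (real p)) \<le> ln (real n)"
proof -
  have "\<Prod>(prime_factors n) dvd n"
    by (rule prod_primes_dvd) auto
  then have "real (\<Prod>(prime_factors n)) \<le> real n"
    using assms by (intro of_nat_mono dvd_imp_le)
  moreover have "(\<Sum>p\<in>prime_factors n. ln (real p)) = ln (real (\<Prod>(prime_factors n)))"
    by (subst of_nat_prod, subst ln_prod) (auto intro!: prime_gt_0_nat)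
  moreover have "real (\<Prod>(prime_factors n)) > 0"
    using in_prime_factors_imp_prime[of _ n] prime_gt_0_nat by (simp add: prod_pos del: of_nat_prod)
  ultimately show ?thesis by simp
qed

lemma euler_factor_le_exp:
  assumes "p \<ge> (2::nat)"
  shows "1 / (1 - 1 / real p) \<le> exp (2 / real p)"
proof -
  have x: "0 \<le> 1 / real p" "1 / real p \<le> 1 / 2" using assms by auto
  have "2 * (1 / real p)\<^sup>2 \<le> 1 / real p"
    using x mult_right_mono[of "2 * (1 / real p)" 1 "1 / real p"] by (simp add: power2_eq_square)
  then have "ln (1 / (1 - 1 / real p)) \<le> 2 / real p"
    using log_excess_bounds(2)[OF x] x by (simp add: log_excess_def ln_div)
  moreover have "1 / (1 - 1 / real p) > 0" using x by simp
  ultimately show ?thesis by (metis exp_le_cancel_iff exp_ln)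
qed

text \<open>The primes up to \<open>y\<close> contribute at most the full product over all primes up to \<open>y\<close>. A prime
  \<open>q > y\<close> contributes at most \<open>exp (2 / q)\<close>, and \<open>2 / q \<le> 2 * ln q / (y * ln y)\<close>; the sum of \<open>ln q\<close> over the prime factors
  is at most \<open>ln n = y\<close>.\<close>

lemma prod_geom_sum_le:
  assumes "n > 0" "y = ln (real n)" "y > exp 1"
  shows "(\<Prod>q\<in>prime_factors n. geom_sum q (multiplicity q n)) \<le> mertens_product y * exp (2 / ln y)"
proof -
  define P where "P = prime_factors n"
  define A where "A = {q \<in> P. real q \<le> y}"
  define B where "B = {q \<in> P. real q > y}"
  have P: "prime q" "q \<ge> 2" if "q \<in> P" for q
    using that by (auto simp: P_def intro: prime_ge_2_nat)
  have ln_nonneg: "ln (real q) \<ge> 0" if "q \<in> P" for q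
    using P(2)[OF that] by simp
  have fin: "finite A" "finite B" "finite P" by (auto simp: A_def B_def P_def)
  have y: "y > 1" "ln y > 1"
  proof -
    show "y > 1" using assms(3) exp_ge_add_one_self[of 1] by linarith
    then show "ln y > 1" using assms(3) by (metis exp_less_cancel_iff exp_ln less_trans zero_less_one)
  qed
  have pos: "1 / (1 - 1 / real q) > 0" "1 / (1 - 1 / real q) \<ge> 1" if "prime q" for q
    using prime_ge_2_nat[OF that] by (auto simp: divide_simps)
  have "(\<Prod>q\<in>P. geom_sum q (multiplicity q n)) \<le> (\<Prod>q\<in>P. 1 / (1 - 1 / real q))"
    using geom_sum_bounds P(2) by (intro prod_mono) (meson order_trans zero_le_one)
  also have "\<dots> = (\<Prod>q\<in>A. 1 / (1 - 1 / real q)) * (\<Prod>q\<in>B. 1 / (1 - 1 / real q))"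
    using fin by (subst prod.union_disjoint[symmetric]) (auto simp: A_def B_def intro!: prod.cong)
  also have "\<dots> \<le> mertens_product y * exp (2 / ln y)"
  proof (rule mult_mono)
    have "A \<subseteq> primes_le y" using P by (auto simp: A_def primes_le_def)
    then show "(\<Prod>q\<in>A. 1 / (1 - 1 / real q)) \<le> mertens_product y"
      unfolding mertens_product_def
      using pos by (intro prod_mono2) (auto simp only: primes_leD(1) finite_primes_le DiffD1 less_imp_le subsetD)
    have "(\<Prod>q\<in>B. 1 / (1 - 1 / real q)) \<le> (\<Prod>q\<in>B. exp (2 / real q))"
    proof (intro prod_mono conjI)
      fix q assume "q \<in> B"
      then have q: "q \<in> P" by (simp add: B_def)
      show "0 \<le> 1 / (1 - 1 / real q)" by (rule less_imp_le[OF pos(1)[OF P(1)[OF q]]])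
      show "1 / (1 - 1 / real q) \<le> exp (2 / real q)" by (rule euler_factor_le_exp[OF P(2)[OF q]])
    qed
    also have "\<dots> = exp (\<Sum>q\<in>B. 2 / real q)" using fin by (simp add: exp_sum)
    also have "(\<Sum>q\<in>B. 2 / real q) \<le> (\<Sum>q\<in>B. 2 / (y * ln y) * ln (real q))"
    proof (rule sum_mono)
      fix q assume "q \<in> B"
      then have q: "real q > y" by (simp add: B_def)
      show "2 / real q \<le> 2 / (y * ln y) * ln (real q)"
      proof -
        have "ln y \<le> ln (real q)" using q y by simp
        then have "2 / real q * 1 \<le> 2 / y * (ln (real q) / ln y)"
          using q y by (intro mult_mono divide_left_mono) auto
        then show ?thesis by simp
      qed
    qed
    also have "\<dots> = 2 / (y * ln y) * (\<Sum>q\<in>B. ln (real q))" by (simp only: sum_distrib_left)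
    also have "\<dots> \<le> 2 / (y * ln y) * y"
    proof (rule mult_left_mono)
      have "(\<Sum>q\<in>B. ln (real q)) \<le> (\<Sum>q\<in>P. ln (real q))"
        using fin ln_nonneg by (intro sum_mono2) (auto simp: B_def)
      also have "\<dots> \<le> y" unfolding P_def assms(2) by (rule sum_ln_prime_factors_le[OF assms(1)])
      finally show "(\<Sum>q\<in>B. ln (real q)) \<le> y" .
    qed (use y in auto)
    also have "\<dots> = 2 / ln y" using y by simp
    finally show "(\<Prod>q\<in>B. 1 / (1 - 1 / real q)) \<le> exp (2 / ln y)" by simp
    show "0 \<le> (\<Prod>q\<in>B. 1 / (1 - 1 / real q))"
      using pos P by (intro prod_nonneg less_imp_le) (auto simp only: B_def mem_Collect_eq)
  qed (use mertens_product_pos in \<open>auto intro: less_imp_le\<close>)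
  finally show ?thesis by (simp only: P_def)
qed

text \<open>For primes up to \<open>y\<close> the weight \<^const>\<open>loglog\<close> is at most \<^term>\<open>loglog y\<close> and Mertens' first theorem applies. For
  primes beyond \<open>y\<close>, \<open>loglog p / p\<close> is at most \<open>loglog y / y\<close>, and again the sum of \<open>ln p\<close> is at most \<open>y\<close>.\<close>

lemma sum_weights_le:
  assumes "n > 0" "y = ln (real n)" "y > exp (exp 1)"
    and C: "(\<Sum>p\<in>primes_le y. ln (real p) / (real p - 1)) \<le> ln y + C"
  shows "(\<Sum>p\<in>prime_factors n. ln (real p) * loglog (real p) / (real p - 1)) \<le> loglog y * (ln y + C + 2)"
proof -
  define P where "P = prime_factors n"
  define A where "A = {q \<in> P. real q \<le> y}"
  define B where "B = {q \<in> P. real q > y}"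
  have P: "prime q" "q \<ge> 2" if "q \<in> P" for q
    using that by (auto simp: P_def intro: prime_ge_2_nat)
  have ln_nonneg: "ln (real q) \<ge> 0" if "q \<in> P" for q
    using P(2)[OF that] by simp
  have fin: "finite A" "finite B" "finite P" by (auto simp: A_def B_def P_def)
  have y: "y > 0" using less_trans[OF exp_gt_zero assms(3)] .
  have ll: "loglog t \<ge> 0" for t using loglog_ge_1[of t] by simp
  have "(\<Sum>p\<in>P. ln (real p) * loglog (real p) / (real p - 1)) =
      (\<Sum>p\<in>A. ln (real p) * loglog (real p) / (real p - 1)) + (\<Sum>p\<in>B. ln (real p) * loglog (real p) / (real p - 1))"
    using fin by (subst sum.union_disjoint[symmetric]) (auto simp: A_def B_def intro!: sum.cong)
  also have "(\<Sum>p\<in>A. ln (real p) * loglog (real p) / (real p - 1)) \<le> loglog y * (ln y + C)"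
  proof -
    have "(\<Sum>p\<in>A. ln (real p) * loglog (real p) / (real p - 1)) \<le> (\<Sum>p\<in>A. loglog y * (ln (real p) / (real p - 1)))"
    proof (rule sum_mono)
      fix p assume "p \<in> A"
      then have p: "p \<ge> 2" "real p \<le> y" using P by (auto simp: A_def)
      have "loglog (real p) * (ln (real p) / (real p - 1)) \<le> loglog y * (ln (real p) / (real p - 1))"
        using p loglog_mono[of "real p" y] by (intro mult_right_mono) auto
      then show "ln (real p) * loglog (real p) / (real p - 1) \<le> loglog y * (ln (real p) / (real p - 1))"
        by (simp add: mult_ac)
    qed
    also have "\<dots> = loglog y * (\<Sum>p\<in>A. ln (real p) / (real p - 1))" by (simp only: sum_distrib_left)
    also have "(\<Sum>p\<in>A. ln (real p) / (real p - 1)) \<le> (\<Sum>p\<in>primes_le y. ln (real p) / (real p - 1))"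
    proof (intro sum_mono2)
      show "A \<subseteq> primes_le y" using P by (auto simp: A_def primes_le_def)
    qed (auto dest!: primes_leD(2))
    finally show ?thesis using C ll by (smt (verit) mult_left_mono)
  qed
  also have "(\<Sum>p\<in>B. ln (real p) * loglog (real p) / (real p - 1)) \<le> 2 * loglog y"
  proof -
    have "(\<Sum>p\<in>B. ln (real p) * loglog (real p) / (real p - 1)) \<le> (\<Sum>p\<in>B. 2 * (loglog y / y) * ln (real p))"
    proof (rule sum_mono)
      fix p assume "p \<in> B"
      then have p: "real p \<ge> 2" "real p > y" using P by (auto simp: B_def)
      have "1 / (real p - 1) \<le> 2 / real p" using p by (simp add: field_simps)
      then have "loglog (real p) * (1 / (real p - 1)) \<le> loglog (real p) * (2 / real p)"
        by (rule mult_left_mono) (rule ll)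
      also have "\<dots> = 2 * (loglog (real p) / real p)" by simp
      also have "\<dots> \<le> 2 * (loglog y / y)"
        using assms(3) p by (intro mult_left_mono loglog_linear_growth) auto
      finally have "loglog (real p) * (1 / (real p - 1)) * ln (real p) \<le> 2 * (loglog y / y) * ln (real p)"
        using p by (intro mult_right_mono) auto
      then show "ln (real p) * loglog (real p) / (real p - 1) \<le> 2 * (loglog y / y) * ln (real p)"
        by (simp add: mult_ac)
    qed
    also have "\<dots> = 2 * (loglog y / y) * (\<Sum>p\<in>B. ln (real p))" by (simp only: sum_distrib_left)
    also have "\<dots> \<le> 2 * (loglog y / y) * y"
    proof (rule mult_left_mono)
      have "(\<Sum>q\<in>B. ln (real q)) \<le> (\<Sum>q\<in>P. ln (real q))"
        using fin ln_nonneg by (intro sum_mono2) (auto simp: B_def)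
      also have "\<dots> \<le> y" unfolding P_def assms(2) by (rule sum_ln_prime_factors_le[OF assms(1)])
      finally show "(\<Sum>q\<in>B. ln (real q)) \<le> y" .
    qed (use y ll in auto)
    finally show ?thesis using y by simp
  qed
  finally show ?thesis by (simp add: P_def algebra_simps)
qed

lemma prod_one_minus_ge:
  fixes a :: "'a \<Rightarrow> real"
  assumes "finite A" "\<And>x. x \<in> A \<Longrightarrow> 0 \<le> a x" "\<And>x. x \<in> A \<Longrightarrow> a x \<le> 1"
  shows "1 - (\<Sum>x\<in>A. a x) \<le> (\<Prod>x\<in>A. 1 - a x)"
  using assms
proof (induction A rule: finite_induct)
  case (insert x A)
  have "1 - (\<Sum>x\<in>insert x A. a x) \<le> (1 - (\<Sum>x\<in>A. a x)) - a x * (\<Prod>x\<in>A. 1 - a x)"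
    using insert by (auto intro!: mult_right_le_one_le prod_nonneg prod_le_1)
  also have "\<dots> \<le> (\<Prod>x\<in>A. 1 - a x) - a x * (\<Prod>x\<in>A. 1 - a x)"
    using insert by auto
  finally show ?case using insert by (simp add: algebra_simps)
qed auto

lemma prod_geom_sum_ge:
  assumes "N \<ge> 1" "prime_factors n = primes_le (real N)" "\<And>p. p \<in> primes_le (real N) \<Longrightarrow> k \<le> multiplicity p n"
  shows "mertens_product N * (1 - real N * (1 / 2) ^ k) \<le> (\<Prod>q\<in>prime_factors n. geom_sum q (multiplicity q n))"
proof -
  let ?a = "\<lambda>q. 1 / real q ^ Suc (multiplicity q n)"
  have a: "0 \<le> ?a q" "?a q \<le> (1 / 2) ^ k" "?a q \<le> 1" if "q \<in> primes_le (real N)" for q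
  proof -
    have q: "real q \<ge> 2" using primes_leD(2)[OF that] .
    have "(2::real) ^ k \<le> 2 ^ Suc (multiplicity q n)"
      using assms(3)[OF that] by (intro power_increasing) auto
    also have "\<dots> \<le> real q ^ Suc (multiplicity q n)" using q by (intro power_mono) auto
    finally have "?a q \<le> 1 / 2 ^ k" by (intro divide_left_mono) (use q in auto)
    then show "?a q \<le> (1 / 2) ^ k" by (simp add: power_one_over)
    also have "\<dots> \<le> 1" by (intro power_le_one) auto
    finally show "?a q \<le> 1" .
  qed simp
  have "card (primes_le (real N)) \<le> card {1..N}"
    by (intro card_mono) (auto simp: primes_le_def Suc_le_eq prime_gt_0_nat)
  then have "real (card (primes_le (real N))) * (1 / 2) ^ k \<le> real N * (1 / 2) ^ k"
    by (intro mult_right_mono) auto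
  moreover have "(\<Sum>q\<in>primes_le (real N). ?a q) \<le> real (card (primes_le (real N))) * (1 / 2) ^ k"
    using a(2) by (rule sum_bounded_above)
  ultimately have "1 - real N * (1 / 2) ^ k \<le> 1 - (\<Sum>q\<in>primes_le (real N). ?a q)"
    by linarith
  also have "\<dots> \<le> (\<Prod>q\<in>primes_le (real N). 1 - ?a q)"
    by (rule prod_one_minus_ge) (use a in auto)
  finally have "mertens_product N * (1 - real N * (1 / 2) ^ k) \<le> mertens_product N * (\<Prod>q\<in>primes_le (real N). 1 - ?a q)"
    using mertens_product_pos by (intro mult_left_mono) (auto intro: less_imp_le)
  also have "\<dots> = (\<Prod>q\<in>primes_le (real N). 1 / (1 - 1 / real q) * (1 - ?a q))"
    by (simp only: mertens_product_def prod.distrib)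
  also have "\<dots> = (\<Prod>q\<in>primes_le (real N). geom_sum q (multiplicity q n))"
    by (intro prod.cong refl) (subst geom_sum_eq, auto dest: primes_leD)
  finally show ?thesis by (simp only: assms(2))
qed

text \<open>Discarding the primes up to \<open>z\<close> allows \<^const>\<open>loglog\<close> to be bounded below by a constant on the rest. With
  \<open>ln z = o(ln x)\<close> and \<open>ln (ln z)\<close> asymptotic to \<open>ln (ln x)\<close> nothing is lost to leading order.\<close>

lemma sum_weights_ge:
  assumes "1 \<le> z" "z \<le> x"
    and C1: "(\<Sum>p\<in>primes_le z. ln (real p) / (real p - 1)) \<le> ln z + C"
    and C2: "ln x - C \<le> (\<Sum>p\<in>primes_le x. ln (real p) / (real p + 1))"
  shows "loglog z * (ln x - ln z - 2 * C) \<le> (\<Sum>p\<in>primes_le x. ln (real p) * loglog (real p) / (real p + 1))"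
proof -
  let ?D = "primes_le x - primes_le z"
  have D: "real p \<ge> 2" "real p > z" if "p \<in> ?D" for p
    using that primes_leD(2)[of p x] by (auto simp: primes_le_def)
  have ll: "loglog t \<ge> 0" for t using loglog_ge_1[of t] by simp
  have "(\<Sum>p\<in>primes_le z. ln (real p) / (real p + 1)) \<le> (\<Sum>p\<in>primes_le z. ln (real p) / (real p - 1))"
    by (intro sum_mono divide_left_mono) (auto dest!: primes_leD(2))
  then have "ln x - ln z - 2 * C \<le> (\<Sum>p\<in>?D. ln (real p) / (real p + 1))"
    using C1 C2 primes_le_mono[OF assms(2)] by (subst sum_diff) auto
  then have "loglog z * (ln x - ln z - 2 * C) \<le> loglog z * (\<Sum>p\<in>?D. ln (real p) / (real p + 1))"
    using ll by (rule mult_left_mono)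
  also have "\<dots> = (\<Sum>p\<in>?D. ln (real p) / (real p + 1) * loglog z)"
    by (simp add: sum_distrib_left mult.commute)
  also have "\<dots> \<le> (\<Sum>p\<in>?D. ln (real p) / (real p + 1) * loglog (real p))"
  proof (intro sum_mono mult_left_mono)
    fix p assume "p \<in> ?D"
    from D[OF this] show "loglog z \<le> loglog (real p)" "0 \<le> ln (real p) / (real p + 1)"
      by (auto intro: loglog_mono)
  qed
  also have "\<dots> = (\<Sum>p\<in>?D. ln (real p) * loglog (real p) / (real p + 1))" by simp
  also have "\<dots> \<le> (\<Sum>p\<in>primes_le x. ln (real p) * loglog (real p) / (real p + 1))"
    using ll by (intro sum_mono2) (auto dest!: primes_leD(2))
  finally show ?thesis .
qed

section \<open>The limit superior\<close>

lemma Phi1_upper: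
  obtains C where "\<And>n. ln (real n) > exp (exp 1) \<Longrightarrow>
    Phi1 n / ((loglog (real n))\<^sup>2 * logloglog (real n))
      \<le> mertens_product (ln (real n)) / ln (ln (real n)) * (exp (2 / ln (ln (real n))) * ((ln (ln (real n)) + C + 2) / ln (ln (real n))))"
proof -
  obtain C where C: "\<And>x. x \<ge> 1 \<Longrightarrow> (\<Sum>p\<in>primes_le x. ln (real p) / (real p - 1)) \<le> ln x + C"
    using mertens_first by metis
  show ?thesis
  proof (rule that[of C])
    fix n assume n: "ln (real n) > exp (exp 1)"
    define y where "y = ln (real n)"
    have y: "y > exp (exp 1)" using n by (simp add: y_def)
    \<comment> \<open>These bounds place \<open>n\<close> and \<open>y\<close> in the range where the truncated iterated logarithms are the usual ones.\<close>
    have e1: "exp (exp 1) > exp (1::real)" "exp (1::real) > 1" by auto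
    have npos: "n > 0" using n e1 by (cases "n = 0") auto
    have ly: "ln y > 1" using y e1 by (metis exp_less_cancel_iff exp_ln less_trans zero_less_one)
    have "real n > exp (exp (exp 1))"
      using n npos by (metis exp_less_cancel_iff exp_ln of_nat_0_less_iff)
    then have "real n \<ge> exp (exp 1)"
      using e1 by (meson exp_less_cancel_iff less_imp_le less_trans)
    then have eqs: "loglog (real n) = ln y" "logloglog (real n) = loglog y"
      using npos by (auto simp: y_def loglog_eq logloglog_eq_loglog_ln)
    have "Phi1 n \<le> (\<Prod>q\<in>prime_factors n. geom_sum q (multiplicity q n)) *
        (\<Sum>p\<in>prime_factors n. ln (real p) * loglog (real p) / (real p - 1))"
      by (rule Phi1_bounds)
    also have "\<dots> \<le> (mertens_product y * exp (2 / ln y)) * (loglog y * (ln y + C + 2))"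
    proof (rule mult_mono)
      show "(\<Prod>q\<in>prime_factors n. geom_sum q (multiplicity q n)) \<le> mertens_product y * exp (2 / ln y)"
        using y e1 by (intro prod_geom_sum_le npos y_def) linarith
      show "(\<Sum>p\<in>prime_factors n. ln (real p) * loglog (real p) / (real p - 1)) \<le> loglog y * (ln y + C + 2)"
        using y e1 by (intro sum_weights_le npos y_def C) linarith+
      show "0 \<le> (\<Sum>p\<in>prime_factors n. ln (real p) * loglog (real p) / (real p - 1))"
      proof (rule sum_nonneg)
        fix p assume "p \<in> prime_factors n"
        then have "p \<ge> 2" by (auto intro: prime_ge_2_nat)
        then show "0 \<le> ln (real p) * loglog (real p) / (real p - 1)"
          using loglog_ge_1[of "real p"] by simp
      qed
    qed (use mertens_product_pos[of y] in simp)
    finally have "Phi1 n / ((ln y)\<^sup>2 * loglog y) \<le> (mertens_product y * exp (2 / ln y)) * (loglog y * (ln y + C + 2)) / ((ln y)\<^sup>2 * loglog y)"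
      using loglog_ge_1[of y] by (intro divide_right_mono) auto
    also have "\<dots> = mertens_product y / ln y * (exp (2 / ln y) * ((ln y + C + 2) / ln y))"
      using loglog_ge_1[of y] ly by (simp add: power2_eq_square)
    finally show "Phi1 n / ((loglog (real n))\<^sup>2 * logloglog (real n))
      \<le> mertens_product (ln (real n)) / ln (ln (real n)) * (exp (2 / ln (ln (real n))) * ((ln (ln (real n)) + C + 2) / ln (ln (real n))))"
      by (simp only: eqs y_def)
  qed
qed

text \<open>The exponent is large enough that \<open>N * (1 / 2) ^ k\<close> tends to 0, so that the local factors are almost full
  geometric series, and small enough that \<open>ln (ln n) = ln N + O(ln (ln N))\<close> for the resulting \<open>n\<close>. Taking powers of the
  factorial makes both the prime factors and the size easy to control.\<close>

definition extremal_exponent :: "nat \<Rightarrow> nat" where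
  "extremal_exponent N = nat \<lceil>4 * ln (real N)\<rceil>"

definition extremal_number :: "nat \<Rightarrow> nat" where
  "extremal_number N = fact N ^ extremal_exponent N"

lemma extremal_number:
  assumes "N \<ge> 2"
  shows "extremal_number N > 0" "prime_factors (extremal_number N) = primes_le (real N)"
    "\<And>p. p \<in> primes_le (real N) \<Longrightarrow> extremal_exponent N \<le> multiplicity p (extremal_number N)"
    "ln (real (extremal_number N)) \<le> (4 * ln (real N) + 1) * (real N * ln (real N))"
    "N \<le> extremal_number N"
proof -
  have k: "real (extremal_exponent N) \<le> 4 * ln (real N) + 1" "extremal_exponent N > 0"
    using assms unfolding extremal_exponent_def by (auto simp: of_nat_ceiling le_of_int_ceiling)
  show "extremal_number N > 0" by (simp add: extremal_number_def)
  show "prime_factors (extremal_number N) = primes_le (real N)"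
    using k(2) by (auto simp: extremal_number_def in_prime_factors_iff primes_le_def prime_dvd_power_iff prime_dvd_fact_iff)
  show "extremal_exponent N \<le> multiplicity p (extremal_number N)" if "p \<in> primes_le (real N)" for p
  proof -
    have "p dvd fact N" using that by (auto simp: primes_le_def prime_dvd_fact_iff)
    then have "multiplicity p (fact N :: nat) \<ge> 1"
      using primes_leD(1)[OF that] by (simp add: prime_multiplicity_gt_zero_iff Suc_le_eq)
    then show ?thesis using primes_leD(1)[OF that]
      by (simp add: extremal_number_def prime_elem_multiplicity_power_distrib)
  qed
  have "ln (real (extremal_number N)) = real (extremal_exponent N) * ln (fact N)"
    by (simp add: extremal_number_def ln_realpow)
  also have "\<dots> \<le> (4 * ln (real N) + 1) * (real N * ln (real N))"
    using k assms by (intro mult_mono ln_fact_bounds) (auto simp: fact_ge_1)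
  finally show "ln (real (extremal_number N)) \<le> (4 * ln (real N) + 1) * (real N * ln (real N))" .
  have "N \<le> fact N" by (rule fact_ge_self)
  also have "fact N \<le> (fact N :: nat) ^ extremal_exponent N"
    using k(2) by (intro self_le_power) auto
  finally show "N \<le> extremal_number N" by (simp add: extremal_number_def)
qed

text \<open>An upper bound for the logarithm of the extremal number.\<close>

definition size_bound :: "real \<Rightarrow> real" where
  "size_bound x = (4 * ln x + 1) * (x * ln x)"

text \<open>The point below which primes are discarded in the lower bound: its logarithm is \<open>o(ln x)\<close>, but its iterated
  logarithm is still asymptotic to \<open>ln (ln x)\<close>.\<close>

definition cutoff :: "real \<Rightarrow> real" where
  "cutoff x = exp (ln x / ln (ln x))"

text \<open>The factor next to \<open>mertens_product N / ln N\<close> tends to 1; it collects the truncation of the geometric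
  series, the loss below the cutoff, and the excess of \<open>ln (ln n)\<close> over \<open>ln N\<close>. The premises hold for all large \<open>N\<close>.\<close>

lemma Phi1_lower:
  obtains C where "\<And>N. size_bound (real N) \<ge> exp (exp 1) \<Longrightarrow> cutoff (real N) \<ge> exp (exp 1) \<Longrightarrow>
      ln (ln (real N)) > 1 \<Longrightarrow>
      2 * C + ln (cutoff (real N)) \<le> ln (real N) \<Longrightarrow>
    mertens_product N / ln (real N) * ((1 - 1 / real N) * ln (real N) *
       (ln (ln (cutoff (real N))) * (ln (real N) - ln (cutoff (real N)) - 2 * C)) /
       ((ln (size_bound (real N)))\<^sup>2 * ln (ln (size_bound (real N)))))
    \<le> Phi1 (extremal_number N) / ((loglog (real (extremal_number N)))\<^sup>2 * logloglog (real (extremal_number N)))"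
proof -
  obtain C where "C \<ge> 0" "\<And>x. x \<ge> 1 \<Longrightarrow> \<bar>(\<Sum>p\<in>primes_le x. ln (real p) / real p) - ln x\<bar> \<le> C"
    and C: "\<And>x. x \<ge> 1 \<Longrightarrow> (\<Sum>p\<in>primes_le x. ln (real p) / (real p - 1)) \<le> ln x + C"
    "\<And>x. x \<ge> 1 \<Longrightarrow> ln x - C \<le> (\<Sum>p\<in>primes_le x. ln (real p) / (real p + 1))"
    by (rule mertens_first) (rule that)
  show ?thesis
  proof (rule that[of C])
    fix N :: nat
    define n where "n = extremal_number N"
    define z where "z = cutoff (real N)"
    define u where "u = size_bound (real N)"
    assume u: "size_bound (real N) \<ge> exp (exp 1)" and z: "cutoff (real N) \<ge> exp (exp 1)"
      and lln: "ln (ln (real N)) > 1"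
      and room: "2 * C + ln (cutoff (real N)) \<le> ln (real N)"
    have e1: "exp (exp 1) > exp (1::real)" "exp (1::real) > 1" by auto
    have lN: "ln (real N) > 1"
    proof (rule ccontr)
      assume "\<not> ln (real N) > 1"
      moreover have "ln (real N) \<ge> 0" by (cases "N = 0") auto
      ultimately have "ln (ln (real N)) \<le> 0" by (cases "ln (real N) = 0") (simp, subst ln_le_zero_iff, auto)
      then show False using lln by simp
    qed
    then have N: "N \<ge> 2" by (cases "N \<le> 1") (auto simp: le_Suc_eq)
    note ext = extremal_number[OF N, folded n_def]
    have zN: "1 \<le> z" "z \<le> real N"
    proof -
      show "1 \<le> z" using z e1 unfolding z_def by linarith
      have "ln (real N) / ln (ln (real N)) \<le> ln (real N)"
        using lN lln divide_left_mono[of 1 "ln (ln (real N))" "ln (real N)"] by simp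
      then have "z \<le> exp (ln (real N))" unfolding z_def cutoff_def by simp
      then show "z \<le> real N" using N by simp
    qed
    have llz: "loglog z = ln (ln z)" using z by (simp add: z_def loglog_eq)
    have nu: "real n \<le> exp u"
    proof -
      have "ln (real n) \<le> u" using ext(4) by (simp add: u_def size_bound_def)
      then have "exp (ln (real n)) \<le> exp u" by simp
      then show ?thesis using ext(1) by simp
    qed
    have "loglog (real n) \<le> loglog (exp u)" using nu by (rule loglog_mono)
    also have "\<dots> = ln u" using order.trans[OF less_imp_le[OF e1(1)] u] by (subst loglog_eq) (auto simp: u_def)
    finally have l2: "loglog (real n) \<le> ln u" .
    have "logloglog (real n) = loglog (ln (real n))" using ext(1) by (intro logloglog_eq_loglog_ln) simp
    also have "\<dots> \<le> loglog u" using ext(4) by (intro loglog_mono) (simp add: u_def size_bound_def)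
    also have "\<dots> = ln (ln u)" using u by (simp add: u_def loglog_eq)
    finally have l3: "logloglog (real n) \<le> ln (ln u)" .
    have l3': "logloglog (real n) \<ge> 1"
      using ext(1) loglog_ge_1[of "ln (real n)"] by (subst logloglog_eq_loglog_ln) auto
    have pow: "real N * (1 / 2) ^ extremal_exponent N \<le> 1 / real N"
    proof -
      \<comment> \<open>Since \<open>ln 2 > 1 / 2\<close>, the exponent makes \<open>2 ^ k\<close> at least \<open>N\<^sup>2\<close>.\<close>
      have "4 * ln (real N) * (1 / 2) \<le> real (extremal_exponent N) * ln 2"
        using lN ln2_ge_two_thirds by (intro mult_mono) (auto simp: extremal_exponent_def of_nat_ceiling)
      then have "exp (2 * ln (real N)) \<le> exp (real (extremal_exponent N) * ln 2)" by simp
      then have "(real N)\<^sup>2 \<le> 2 ^ extremal_exponent N"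
        using N by (simp add: exp_of_nat_mult exp_double)
      then have "(1 / 2 :: real) ^ extremal_exponent N \<le> 1 / (real N)\<^sup>2"
        using N unfolding power_one_over by (intro divide_left_mono) auto
      then have "real N * (1 / 2) ^ extremal_exponent N \<le> real N * (1 / (real N)\<^sup>2)"
        by (intro mult_left_mono) auto
      then show ?thesis using N by (simp add: power2_eq_square)
    qed
    define R where "R = mertens_product N * (1 - 1 / real N) * (ln (ln z) * (ln (real N) - ln z - 2 * C))"
    have factor1: "mertens_product N * (1 - 1 / real N) \<ge> 0"
      using mertens_product_pos[of "real N"] N by simp
    have factor2: "ln (ln z) * (ln (real N) - ln z - 2 * C) \<ge> 0"
      using room loglog_ge_1[of z] by (simp add: z_def llz[symmetric, unfolded z_def])
    have Rpos: "R \<ge> 0" unfolding R_def by (rule mult_nonneg_nonneg[OF factor1 factor2])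
    have "R \<le> (\<Prod>q\<in>prime_factors n. geom_sum q (multiplicity q n)) *
        (\<Sum>p\<in>prime_factors n. ln (real p) * loglog (real p) / (real p + 1))"
      unfolding R_def
    proof (rule mult_mono)
      have "mertens_product N * (1 - 1 / real N) \<le> mertens_product N * (1 - real N * (1 / 2) ^ extremal_exponent N)"
        using pow mertens_product_pos[of "real N"] by (intro mult_left_mono) auto
      also have "\<dots> \<le> (\<Prod>q\<in>prime_factors n. geom_sum q (multiplicity q n))"
        using N by (intro prod_geom_sum_ge ext(2,3)) auto
      finally show "mertens_product N * (1 - 1 / real N) \<le> (\<Prod>q\<in>prime_factors n. geom_sum q (multiplicity q n))" .
      then show "0 \<le> (\<Prod>q\<in>prime_factors n. geom_sum q (multiplicity q n))" using factor1 by linarith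
      show "ln (ln z) * (ln (real N) - ln z - 2 * C) \<le> (\<Sum>p\<in>prime_factors n. ln (real p) * loglog (real p) / (real p + 1))"
        unfolding ext(2) llz[symmetric] using zN by (intro sum_weights_ge C) auto
    qed (rule factor2)
    also have "\<dots> \<le> Phi1 n" by (rule Phi1_bounds)
    finally have "R / ((ln u)\<^sup>2 * ln (ln u)) \<le> Phi1 n / ((loglog (real n))\<^sup>2 * logloglog (real n))"
      using l2 l3 l3' loglog_ge_1[of "real n"] Rpos
      by (intro frac_le mult_mono power_mono mult_pos_pos zero_less_power) auto
    moreover have "R / ((ln u)\<^sup>2 * ln (ln u)) = mertens_product N / ln (real N) * ((1 - 1 / real N) * ln (real N) *
       (ln (ln z) * (ln (real N) - ln z - 2 * C)) / ((ln u)\<^sup>2 * ln (ln u)))"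
      unfolding R_def using lN by simp
    ultimately show "mertens_product N / ln (real N) * ((1 - 1 / real N) * ln (real N) *
       (ln (ln (cutoff (real N))) * (ln (real N) - ln (cutoff (real N)) - 2 * C)) /
       ((ln (size_bound (real N)))\<^sup>2 * ln (ln (size_bound (real N)))))
    \<le> Phi1 (extremal_number N) / ((loglog (real (extremal_number N)))\<^sup>2 * logloglog (real (extremal_number N)))"
      by (simp only: n_def z_def u_def)
  qed
qed

lemma Limsup_mono_filter:
  fixes f :: "'a \<Rightarrow> 'b :: complete_lattice"
  assumes "F \<le> G"
  shows "Limsup F f \<le> Limsup G f"
  unfolding Limsup_def using assms by (intro INF_superset_mono) (auto simp: le_filter_def)

theorem mainTheorem3:
  "limsup (\<lambda>n::nat. ereal (Phi1 n / ((loglog (real n))\<^sup>2 * logloglog (real n))))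
     = ereal (exp (euler_mascheroni :: real))"
proof (rule antisym)
  let ?g = "\<lambda>n::nat. Phi1 n / ((loglog (real n))\<^sup>2 * logloglog (real n))"
  obtain C where upper: "\<And>n. ln (real n) > exp (exp 1) \<Longrightarrow> ?g n
      \<le> mertens_product (ln (real n)) / ln (ln (real n)) * (exp (2 / ln (ln (real n))) * ((ln (ln (real n)) + C + 2) / ln (ln (real n))))"
    using Phi1_upper by blast
  let ?h = "\<lambda>n::nat. mertens_product (ln (real n)) / ln (ln (real n)) * (exp (2 / ln (ln (real n))) * ((ln (ln (real n)) + C + 2) / ln (ln (real n))))"
  have "filterlim (\<lambda>n::nat. ln (real n)) at_top at_top" by real_asymp
  from filterlim_compose[OF mertens_third this]
  have "(\<lambda>n. mertens_product (ln (real n)) / ln (ln (real n))) \<longlonglongrightarrow> exp euler_mascheroni" .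
  moreover have "(\<lambda>n::nat. exp (2 / ln (ln (real n))) * ((ln (ln (real n)) + C + 2) / ln (ln (real n)))) \<longlonglongrightarrow> 1"
    by real_asymp
  ultimately have "?h \<longlonglongrightarrow> exp euler_mascheroni * 1" by (rule tendsto_mult)
  then have "(\<lambda>n. ereal (?h n)) \<longlonglongrightarrow> ereal (exp euler_mascheroni)" by simp
  then have "limsup (\<lambda>n. ereal (?h n)) = ereal (exp euler_mascheroni)"
    by (rule lim_imp_Limsup[rotated]) simp
  moreover have "\<forall>\<^sub>F n::nat in sequentially. ln (real n) > exp (exp 1)" by real_asymp
  then have "\<forall>\<^sub>F n in sequentially. ereal (?g n) \<le> ereal (?h n)"
    by eventually_elim (use upper in simp)
  then have "limsup (\<lambda>n. ereal (?g n)) \<le> limsup (\<lambda>n. ereal (?h n))" by (rule Limsup_mono)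
  ultimately show "limsup (\<lambda>n. ereal (?g n)) \<le> ereal (exp euler_mascheroni)" by simp
next
  let ?g = "\<lambda>n::nat. Phi1 n / ((loglog (real n))\<^sup>2 * logloglog (real n))"
  obtain C where lower: "\<And>N. size_bound (real N) \<ge> exp (exp 1) \<Longrightarrow> cutoff (real N) \<ge> exp (exp 1) \<Longrightarrow>
      ln (ln (real N)) > 1 \<Longrightarrow>
      2 * C + ln (cutoff (real N)) \<le> ln (real N) \<Longrightarrow>
    mertens_product N / ln (real N) * ((1 - 1 / real N) * ln (real N) *
       (ln (ln (cutoff (real N))) * (ln (real N) - ln (cutoff (real N)) - 2 * C)) /
       ((ln (size_bound (real N)))\<^sup>2 * ln (ln (size_bound (real N)))))
    \<le> ?g (extremal_number N)"
    using Phi1_lower by blast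
  let ?h = "\<lambda>N::nat. mertens_product N / ln (real N) * ((1 - 1 / real N) * ln (real N) *
       (ln (ln (cutoff (real N))) * (ln (real N) - ln (cutoff (real N)) - 2 * C)) /
       ((ln (size_bound (real N)))\<^sup>2 * ln (ln (size_bound (real N)))))"
  have "(\<lambda>N. mertens_product (real N) / ln (real N)) \<longlonglongrightarrow> exp euler_mascheroni"
    using filterlim_compose[OF mertens_third filterlim_real_sequentially] .
  moreover have "(\<lambda>N::nat. (1 - 1 / real N) * ln (real N) *
       (ln (ln (cutoff (real N))) * (ln (real N) - ln (cutoff (real N)) - 2 * C)) /
       ((ln (size_bound (real N)))\<^sup>2 * ln (ln (size_bound (real N))))) \<longlonglongrightarrow> 1"
    unfolding cutoff_def size_bound_def ln_exp by real_asymp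
  ultimately have "?h \<longlonglongrightarrow> exp euler_mascheroni * 1" by (rule tendsto_mult)
  then have "(\<lambda>n. ereal (?h n)) \<longlonglongrightarrow> ereal (exp euler_mascheroni)" by simp
  then have "ereal (exp euler_mascheroni) = limsup (\<lambda>n. ereal (?h n))"
    by (intro lim_imp_Limsup[symmetric]) simp_all
  also have "\<dots> \<le> limsup (\<lambda>N. ereal (?g (extremal_number N)))"
  proof (rule Limsup_mono)
    have "\<forall>\<^sub>F N::nat in sequentially. size_bound (real N) \<ge> exp (exp 1)"
      unfolding size_bound_def by real_asymp
    moreover have "\<forall>\<^sub>F N::nat in sequentially. cutoff (real N) \<ge> exp (exp 1)"
      unfolding cutoff_def by real_asymp
    moreover have "\<forall>\<^sub>F N::nat in sequentially. ln (ln (real N)) > 1" by real_asymp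
    moreover have "\<forall>\<^sub>F N::nat in sequentially. 2 * C + ln (cutoff (real N)) \<le> ln (real N)"
      unfolding cutoff_def ln_exp by real_asymp
    ultimately show "\<forall>\<^sub>F N in sequentially. ereal (?h N) \<le> ereal (?g (extremal_number N))"
      by eventually_elim (simp only: ereal_less_eq lower)
  qed
  also have "\<dots> \<le> Limsup (filtermap extremal_number sequentially) (\<lambda>n. ereal (?g n))"
    by (rule Limsup_filtermap_ge)
  also have "\<dots> \<le> limsup (\<lambda>n. ereal (?g n))"
  proof (rule Limsup_mono_filter)
    have "filterlim extremal_number at_top sequentially"
    proof (rule filterlim_at_top_mono[OF filterlim_ident])
      show "\<forall>\<^sub>F N in sequentially. N \<le> extremal_number N"
        using eventually_ge_at_top[of 2] by eventually_elim (rule extremal_number(5))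
    qed
    then show "filtermap extremal_number sequentially \<le> sequentially" by (simp add: filterlim_def)
  qed
  finally show "ereal (exp euler_mascheroni) \<le> limsup (\<lambda>n. ereal (?g n))" .
qed

end
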